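(* For every real number $r$ with $2<r<\infty$, the pair of Banach spaces $(\ell_2,L_r([0,1]))$ fails to have the compact perturbation property.
   Context: $\ell_2$ is the usual Hilbert space of square-summable scalar sequences and $L_r([0,1])$ is the usual Lebesgue space on $[0,1]$ with Lebesgue measure and its usual norm; the scalar field $\mathbb{K}$ is $\mathbb{R}$ or $\mathbb{C}$ (the same for both spaces), and the result is asserted for each choice. A bounded linear operator $R:X\to Y$ between Banach spaces is norm-attaining if there is $x\in X$ with $\|x\|=1$ and $\|R(x)\|=\|R\|$. A pair of Banach spaces $(X,Y)$ has the compact perturbation property (CPP) if $T+K$ is norm-attaining whenever $T:X\to Y$ is a bounded linear operator and $K:X\to Y$ is a compact operator such that $\|T\|<\|T+K\|$. *)

theory Defs
  imports "HOL-Analysis.Analysis" "HOL-Library.Function_Algebras"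
begin

text \<open>
  Since the exponent of a Lebesgue space is a term, normed spaces are given here by a carrier
  inside an ambient additive group, together with a scalar multiplication and a norm.
  All notions below only look at values on the carrier.
\<close>

record ('k, 'v) normed_space =
  pts :: "'v set"
  scal :: "'k \<Rightarrow> 'v \<Rightarrow> 'v"
  nrm :: "'v \<Rightarrow> real"

definition norm_topology :: "('k, 'v::ab_group_add) normed_space \<Rightarrow> 'v topology" where
  "norm_topology X = Metric_space.mtopology (pts X) (\<lambda>x y. nrm X (x - y))"

definition unit_ball :: "('k, 'v) normed_space \<Rightarrow> 'v set" where
  "unit_ball X = {x \<in> pts X. nrm X x \<le> 1}"

definition linear_op ::
  "('k, 'v::ab_group_add) normed_space \<Rightarrow> ('k, 'w::ab_group_add) normed_space \<Rightarrow> ('v \<Rightarrow> 'w) \<Rightarrow> bool"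
  where "linear_op X Y T \<longleftrightarrow>
    (\<forall>x\<in>pts X. T x \<in> pts Y) \<and>
    (\<forall>x\<in>pts X. \<forall>y\<in>pts X. T (x + y) = T x + T y) \<and>
    (\<forall>c. \<forall>x\<in>pts X. T (scal X c x) = scal Y c (T x))"

definition bounded_linear_op ::
  "('k, 'v::ab_group_add) normed_space \<Rightarrow> ('k, 'w::ab_group_add) normed_space \<Rightarrow> ('v \<Rightarrow> 'w) \<Rightarrow> bool"
  where "bounded_linear_op X Y T \<longleftrightarrow>
    linear_op X Y T \<and> (\<exists>B. \<forall>x\<in>pts X. nrm Y (T x) \<le> B * nrm X x)"

definition compact_op ::
  "('k, 'v::ab_group_add) normed_space \<Rightarrow> ('k, 'w::ab_group_add) normed_space \<Rightarrow> ('v \<Rightarrow> 'w) \<Rightarrow> bool"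
  where "compact_op X Y K \<longleftrightarrow>
    linear_op X Y K \<and>
    compactin (norm_topology Y) (norm_topology Y closure_of (K ` unit_ball X))"

definition op_norm ::
  "('k, 'v) normed_space \<Rightarrow> ('k, 'w) normed_space \<Rightarrow> ('v \<Rightarrow> 'w) \<Rightarrow> real"
  where "op_norm X Y T = (SUP x\<in>unit_ball X. nrm Y (T x))"

definition norm_attaining ::
  "('k, 'v) normed_space \<Rightarrow> ('k, 'w) normed_space \<Rightarrow> ('v \<Rightarrow> 'w) \<Rightarrow> bool"
  where "norm_attaining X Y R \<longleftrightarrow> (\<exists>x\<in>pts X. nrm X x = 1 \<and> nrm Y (R x) = op_norm X Y R)"

definition compact_perturbation_property ::
  "('k, 'v::ab_group_add) normed_space \<Rightarrow> ('k, 'w::ab_group_add) normed_space \<Rightarrow> bool"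
  where "compact_perturbation_property X Y \<longleftrightarrow>
    (\<forall>T K. bounded_linear_op X Y T \<and> compact_op X Y K \<and>
       op_norm X Y T < op_norm X Y (\<lambda>x. T x + K x) \<longrightarrow>
       norm_attaining X Y (\<lambda>x. T x + K x))"

definition ell2 :: "('k::real_normed_field, nat \<Rightarrow> 'k) normed_space" where
  "ell2 = \<lparr>pts = {x. summable (\<lambda>n. (norm (x n))\<^sup>2)},
           scal = (\<lambda>c x n. c * x n),
           nrm = (\<lambda>x. sqrt (\<Sum>n. (norm (x n))\<^sup>2))\<rparr>"

abbreviation unit_interval_measure :: "real measure" where
  "unit_interval_measure \<equiv> lebesgue_on {0..1}"

text \<open>
  The ambient space for all the Lebesgue spaces on the unit interval: classes of measurable
  functions modulo equality almost everywhere. Values outside the unit interval are irrelevant.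
\<close>

definition ae_eq :: "(real \<Rightarrow> 'k::{real_normed_field, second_countable_topology}) \<Rightarrow> (real \<Rightarrow> 'k) \<Rightarrow> bool"
  where "ae_eq f g \<longleftrightarrow>
    f \<in> borel_measurable unit_interval_measure \<and>
    g \<in> borel_measurable unit_interval_measure \<and>
    (AE t in unit_interval_measure. f t = g t)"

quotient_type (overloaded) 'k ae_fun =
  "real \<Rightarrow> 'k::{real_normed_field, second_countable_topology}" / partial: ae_eq
proof (rule part_equivpI)
  show "\<exists>f::real \<Rightarrow> 'k. ae_eq f f"
    by (rule exI[of _ "\<lambda>_. 0"]) (simp add: ae_eq_def)
  show "symp (ae_eq :: (real \<Rightarrow> 'k) \<Rightarrow> _)"
    by (auto simp: symp_def ae_eq_def elim: eventually_mono)
  show "transp (ae_eq :: (real \<Rightarrow> 'k) \<Rightarrow> _)"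
    by (auto simp: transp_def ae_eq_def elim: eventually_elim2)
qed

instantiation ae_fun :: ("{real_normed_field, second_countable_topology}") ab_group_add
begin

lift_definition zero_ae_fun :: "'a ae_fun" is "\<lambda>_. 0"
  by (simp add: ae_eq_def)

lift_definition plus_ae_fun :: "'a ae_fun \<Rightarrow> 'a ae_fun \<Rightarrow> 'a ae_fun" is "\<lambda>f g t. f t + g t"
  by (auto simp: ae_eq_def elim: eventually_elim2)

lift_definition uminus_ae_fun :: "'a ae_fun \<Rightarrow> 'a ae_fun" is "\<lambda>f t. - f t"
  by (auto simp: ae_eq_def elim: eventually_mono)

lift_definition minus_ae_fun :: "'a ae_fun \<Rightarrow> 'a ae_fun \<Rightarrow> 'a ae_fun" is "\<lambda>f g t. f t - g t"
  by (auto simp: ae_eq_def elim: eventually_elim2)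

instance
  by standard (transfer; simp add: ae_eq_def algebra_simps)+

end

lift_definition scale_ae_fun ::
  "'k::{real_normed_field, second_countable_topology} \<Rightarrow> 'k ae_fun \<Rightarrow> 'k ae_fun"
  is "\<lambda>c f t. c * f t"
  by (auto simp: ae_eq_def elim: eventually_mono)

lift_definition in_Lebesgue ::
  "real \<Rightarrow> 'k::{real_normed_field, second_countable_topology} ae_fun \<Rightarrow> bool"
  is "\<lambda>r f. integrable unit_interval_measure (\<lambda>t. norm (f t) powr r)"
  by (rule integrable_cong_AE) (auto simp: ae_eq_def elim: eventually_mono)

lift_definition Lebesgue_norm ::
  "real \<Rightarrow> 'k::{real_normed_field, second_countable_topology} ae_fun \<Rightarrow> real"
  is "\<lambda>r f. (LINT t|unit_interval_measure. norm (f t) powr r) powr (1 / r)"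
  by (rule arg_cong[where f = "\<lambda>s. s powr _"], rule integral_cong_AE)
     (auto simp: ae_eq_def elim: eventually_mono)

definition Lebesgue_space ::
  "real \<Rightarrow> ('k::{real_normed_field, second_countable_topology}, 'k ae_fun) normed_space"
  where "Lebesgue_space r =
    \<lparr>pts = {f. in_Lebesgue r f}, scal = scale_ae_fun, nrm = Lebesgue_norm r\<rparr>"

end

theory Submission
  imports Defs "HOL-Real_Asymp.Real_Asymp"
begin

text \<open>
  Let \<open>\<epsilon>\<^sub>0, \<epsilon>\<^sub>1, \<dots>\<close> be the Rademacher functions on the unit interval. By Khintchine's inequality
  the series \<open>\<Sum>n. x\<^sub>n \<epsilon>\<^sub>n\<close> converges in \<open>L\<^sub>r\<close> for every square-summable \<open>x\<close>. As the
  \<open>\<epsilon>\<^sub>n\<close> are independent random signs, the norm of the sum does not change when the coordinates of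
  \<open>x\<close> are moved to other positions, and it increases strictly with the modulus of every coordinate.
  Hence a diagonal operator \<open>S x = \<Sum>n. w\<^sub>n x\<^sub>n \<epsilon>\<^sub>n\<close> whose weights are positive and strictly increase
  from index 1 on cannot attain its norm at an \<open>x\<close> with a nonzero coordinate beyond index 0: moving the
  coordinates \<open>x\<^sub>1, x\<^sub>2, \<dots>\<close> one place to the right preserves the norm of \<open>x\<close> and multiplies each of
  them by a larger weight (\<open>spread_tail_increases_norm\<close>).

  Split \<open>S\<close> as \<open>T + K\<close>, where \<open>K\<close> keeps only the coordinate 0 and has rank one. What is left is
  to choose the weights so that \<open>\<parallel>S\<parallel>\<close> exceeds both \<open>\<parallel>T\<parallel>\<close> and \<open>w\<^sub>0\<close>, the norm of \<open>S\<close> at the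
  first unit vector. This is where \<open>r > 2\<close> enters, because \<open>r - 1\<close> separates two constants.
  Khintchine's inequality holds with a constant \<open>C\<close> such that \<open>C\<^sup>2 < r - 1\<close>
  (\<open>khintchine_constant\<close>), so that \<open>\<parallel>T\<parallel> \<le> C\<close> as soon as the weights of \<open>T\<close> are at most 1; and the
  second-order expansion of \<open>\<parallel>C \<epsilon>\<^sub>0 + t \<epsilon>\<^sub>1\<parallel>\<^sub>r\<^sup>2\<close> is \<open>C\<^sup>2 + (r - 1) t\<^sup>2\<close>, which for small \<open>t\<close>
  is more than \<open>C\<^sup>2 (1 + t\<^sup>2)\<close> (\<open>two_point_gain\<close>). So \<open>w\<^sub>0 = C\<close> and weights increasing
  towards 1 from a value \<open>q\<close> with \<open>C\<^sup>2 < q\<^sup>2 (r - 1)\<close> do what is needed.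

  All norms are computed as limits of finite averages over signs (\<open>rad_mean\<close>), so the inequalities
  are finite and work for Hilbert-space valued coefficients; in particular the real and the complex
  scalar field are treated together. Measure theory is used only to realise these averages as
  integrals, and to see that \<open>L\<^sub>r\<close> is a complete metric space.
\<close>

section \<open>Convexity of powers of the norm\<close>

lemma convex_on_powr_nonneg:
  fixes p :: real
  assumes "1 \<le> p"
  shows "convex_on {0..} (\<lambda>s. s powr p)"
proof (rule convex_onI)
  fix t a b :: real
  assume t: "0 < t" "t < 1" and ab: "a \<in> {0..}" "b \<in> {0..}"
  have scale: "(u * s) powr p \<le> u * s powr p" if "0 < u" "u < 1" "0 \<le> s" for u s :: real
  proof -
    have "u powr p \<le> u powr 1"
      using that assms by (intro powr_mono') auto
    then show ?thesis
      using that by (simp add: powr_mult mult_right_mono)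
  qed
  consider "a = 0" | "b = 0" | "0 < a" "0 < b"
    using ab by force
  then show "((1 - t) *\<^sub>R a + t *\<^sub>R b) powr p \<le> (1 - t) * a powr p + t * b powr p"
  proof cases
    case 1
    then show ?thesis
      using scale[of t b] t ab by simp
  next
    case 2
    then show ?thesis
      using scale[of "1 - t" a] t ab by simp
  next
    case 3
    then show ?thesis
      using convex_onD[OF powr_convex[OF assms], of t a b] t by simp
  qed
qed simp

lemma powr_superadditive:
  fixes a b p :: real
  assumes "0 \<le> a" "0 \<le> b" "1 \<le> p"
  shows "a powr p + b powr p \<le> (a + b) powr p"
proof (cases "a + b = 0")
  case True
  then show ?thesis
    using assms by (simp add: add_nonneg_eq_0_iff)
next
  case False
  define s where "s = a + b"
  have s: "0 < s"
    using False assms by (simp add: s_def)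
  have part: "c powr p \<le> c / s * s powr p" if "0 \<le> c" "c \<le> s" for c
  proof -
    have "(c / s) powr p \<le> c / s"
    proof (cases "c = 0")
      case False
      then have "(c / s) powr p \<le> (c / s) powr 1"
        using that s assms by (intro powr_mono') auto
      then show ?thesis using that s by simp
    qed simp
    then have "(c / s) powr p * s powr p \<le> c / s * s powr p"
      by (intro mult_right_mono) auto
    then show ?thesis
      using that s by (simp add: powr_divide)
  qed
  have "a powr p + b powr p \<le> a / s * s powr p + b / s * s powr p"
    using assms by (intro add_mono part) (auto simp: s_def)
  also have "\<dots> = (a + b) / s * s powr p"
    by (simp add: add_divide_distrib distrib_right)
  also have "\<dots> = s powr p"
    using s by (simp add: s_def)
  finally show ?thesis
    by (simp add: s_def)
qed

lemma powr_le_powr_imp_le: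
  fixes a b r :: real
  assumes "a powr r \<le> b powr r" "0 < r" "0 \<le> a" "0 \<le> b"
  shows "a \<le> b"
  using assms powr_less_mono2[of r b a] by (meson not_le)

lemma convex_on_norm_powr:
  fixes r :: real
  assumes "1 \<le> r"
  shows "convex_on UNIV (\<lambda>v::'a::real_normed_vector. norm v powr r)"
proof (rule convex_onI)
  fix t :: real and x y :: 'a
  assume t: "0 < t" "t < 1"
  have "norm ((1 - t) *\<^sub>R x + t *\<^sub>R y) powr r \<le> ((1 - t) *\<^sub>R norm x + t *\<^sub>R norm y) powr r"
    using t assms by (intro powr_mono2) (auto intro: order_trans[OF norm_triangle_ineq])
  also have "\<dots> \<le> (1 - t) * norm x powr r + t * norm y powr r"
    using convex_onD[OF convex_on_powr_nonneg[OF assms], of t "norm x" "norm y"] t by simp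
  finally show "norm ((1 - t) *\<^sub>R x + t *\<^sub>R y) powr r \<le> (1 - t) * norm x powr r + t * norm y powr r" .
qed simp

text \<open>
  A quantitative form of strict convexity: by the parallelogram law the squares
  \<open>(norm (v + c))\<^sup>2\<close> and \<open>(norm (v - c))\<^sup>2\<close> have mean \<open>(norm v)\<^sup>2 + (norm c)\<^sup>2\<close>, and
  \<open>s \<mapsto> s powr (r / 2)\<close> is convex and superadditive. The gap \<open>norm c powr r\<close> does not depend on \<open>v\<close>;
  this is what lets it survive averaging and passage to the limit.
\<close>

lemma norm_powr_midpoint_gap:
  fixes v c :: "'a::real_inner"
  assumes "2 \<le> r"
  shows "norm v powr r + norm c powr r \<le> (norm (v + c) powr r + norm (v - c) powr r) / 2"
proof -
  have sq: "norm w powr r = ((norm w)\<^sup>2) powr (r / 2)" for w :: 'a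
    by (cases "w = 0") (simp_all add: powr_powr flip: powr_numeral)
  have par: "(1 - 1/2) *\<^sub>R (norm (v + c))\<^sup>2 + (1/2) *\<^sub>R (norm (v - c))\<^sup>2 = (norm v)\<^sup>2 + (norm c)\<^sup>2"
    by (simp add: power2_norm_eq_inner inner_simps inner_commute field_simps)
  have "norm v powr r + norm c powr r \<le> ((norm v)\<^sup>2 + (norm c)\<^sup>2) powr (r / 2)"
    unfolding sq using assms by (intro powr_superadditive) auto
  also have "\<dots> \<le> (1 - 1/2) * ((norm (v + c))\<^sup>2) powr (r / 2) + (1/2) * ((norm (v - c))\<^sup>2) powr (r / 2)"
    unfolding par[symmetric] using assms
    by (intro convex_onD[OF convex_on_powr_nonneg]) auto
  finally show ?thesis
    unfolding sq by simp
qed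

section \<open>Averages over signs\<close>

text \<open>
  The expectation of \<open>F (v + (\<Sum>j<n. \<epsilon>\<^sub>j x\<^sub>j))\<close> for independent uniform signs \<open>\<epsilon>\<^sub>j\<close>. The recursion
  splits off the first sign, which matches the self-similarity of the Rademacher functions under
  \<open>t \<mapsto> 2 t\<close>.
\<close>

primrec rad_mean :: "('a::real_vector \<Rightarrow> real) \<Rightarrow> nat \<Rightarrow> (nat \<Rightarrow> 'a) \<Rightarrow> 'a \<Rightarrow> real" where
  "rad_mean F 0 x v = F v"
| "rad_mean F (Suc n) x v =
    (rad_mean F n (\<lambda>j. x (Suc j)) (v + x 0) + rad_mean F n (\<lambda>j. x (Suc j)) (v - x 0)) / 2"

lemma rad_mean_Suc_last:
  "rad_mean F (Suc n) x v = rad_mean (\<lambda>u. (F (u + x n) + F (u - x n)) / 2) n x v"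
proof (induction n arbitrary: x v)
  case (Suc n)
  show ?case
    unfolding rad_mean.simps(2)[of F "Suc n"] Suc.IH by simp
qed simp

lemma rad_mean_mono: "(\<And>u. F u \<le> G u) \<Longrightarrow> rad_mean F n x v \<le> rad_mean G n x v"
  by (induction n arbitrary: x v) (auto intro!: divide_right_mono add_mono)

lemma rad_mean_cmult: "rad_mean (\<lambda>u. c * F u) n x v = c * rad_mean F n x v"
  by (induction n arbitrary: x v) (auto simp: algebra_simps)

lemma rad_mean_add: "rad_mean (\<lambda>u. F u + G u) n x v = rad_mean F n x v + rad_mean G n x v"
  by (induction n arbitrary: x v) (auto simp: field_simps)

lemma rad_mean_sum: "rad_mean (\<lambda>u. \<Sum>i\<in>A. F i u) n x v = (\<Sum>i\<in>A. rad_mean (F i) n x v)"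
proof (induction A rule: infinite_finite_induct)
  case (insert i A)
  then show ?case by (simp add: rad_mean_add)
qed (use rad_mean_cmult[of 0] in simp_all)

lemma rad_mean_nonneg: "(\<And>u. 0 \<le> F u) \<Longrightarrow> 0 \<le> rad_mean F n x v"
  by (induction n arbitrary: x v) auto

lemma rad_mean_zero: "(\<And>j. j < n \<Longrightarrow> x j = 0) \<Longrightarrow> rad_mean F n x v = F v"
  by (induction n arbitrary: x v) auto

lemma convex_on_rad_mean:
  assumes "convex_on UNIV F"
  shows "convex_on UNIV (rad_mean F n x)"
proof (induction n arbitrary: x)
  case 0
  then show ?case using assms by simp
next
  case (Suc n)
  let ?G = "rad_mean F n (\<lambda>j. x (Suc j))"
  have G: "convex_on UNIV ?G"
    by (rule Suc)
  show ?case
  proof (rule convex_onI)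
    fix t :: real and a b :: 'a
    assume t: "0 < t" "t < 1"
    have "?G ((1 - t) *\<^sub>R a + t *\<^sub>R b + c) \<le> (1 - t) * ?G (a + c) + t * ?G (b + c)" for c
      using convex_onD[OF G, of t "a + c" "b + c"] t by (simp add: algebra_simps)
    from this[of "x 0"] this[of "- x 0"]
    show "rad_mean F (Suc n) x ((1 - t) *\<^sub>R a + t *\<^sub>R b)
        \<le> (1 - t) * rad_mean F (Suc n) x a + t * rad_mean F (Suc n) x b"
      by (simp add: field_simps)
  qed simp
qed

text \<open>
  Averaging over signs only superposes translates of \<open>F\<close>, and the midpoint gap does not depend on
  the point \<open>v\<close>.
\<close>

lemma rad_mean_midpoint_gap:
  assumes "\<And>v c. F v + g c \<le> (F (v + c) + F (v - c)) / 2"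
  shows "rad_mean F n x v + g c \<le> (rad_mean F n x (v + c) + rad_mean F n x (v - c)) / 2"
proof (induction n arbitrary: x v)
  case 0
  then show ?case using assms by simp
next
  case (Suc n)
  let ?G = "rad_mean F n (\<lambda>j. x (Suc j))"
  have shifts: "v + x 0 + c = v + c + x 0" "v + x 0 - c = v - c + x 0"
    "v - x 0 + c = v + c - x 0" "v - x 0 - c = v - c - x 0"
    by simp_all
  show ?case
    using Suc[of "\<lambda>j. x (Suc j)" "v + x 0"] Suc[of "\<lambda>j. x (Suc j)" "v - x 0"]
    unfolding shifts rad_mean.simps by argo
qed

lemma convex_dilation_gap:
  fixes t :: real
  assumes "convex_on UNIV G" "1 \<le> t"
  shows "t * (G (v + c) + G (v - c)) \<le> G (v + t *\<^sub>R c) + G (v - t *\<^sub>R c) + 2 * (t - 1) * G v"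
proof -
  have one: "t * G (v + d) \<le> G (v + t *\<^sub>R d) + (t - 1) * G v" for d
  proof -
    have "v + d = (1 - 1/t) *\<^sub>R v + (1/t) *\<^sub>R (v + t *\<^sub>R d)"
      using assms(2) by (simp add: algebra_simps)
    then have "G (v + d) \<le> (1 - 1/t) * G v + (1/t) * G (v + t *\<^sub>R d)"
      using convex_onD[OF assms(1), of "1/t" v "v + t *\<^sub>R d"] assms(2) by simp
    from mult_left_mono[OF this, of t] have "t * G (v + d) \<le> t * ((1 - 1/t) * G v + (1/t) * G (v + t *\<^sub>R d))"
      using assms(2) by simp
    also have "\<dots> = G (v + t *\<^sub>R d) + (t - 1) * G v"
      using assms(2) by (simp add: algebra_simps)
    finally show ?thesis .
  qed
  show ?thesis
    using one[of c] one[of "- c"] by (simp add: algebra_simps)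
qed

text \<open>
  Enlarging coefficients increases the average, and one genuinely enlarged coefficient increases
  it by an amount independent of \<open>n\<close>. Indeed, the average as a function of the scale of
  one coefficient is convex and even, and the midpoint gap bounds its growth between the scales 0
  and 1 from below; convexity carries that growth beyond scale 1.
\<close>

lemma rad_mean_dilation_gap:
  fixes F :: "'a::real_vector \<Rightarrow> real"
  assumes F: "convex_on UNIV F" and gap: "\<And>v c. F v + g c \<le> (F (v + c) + F (v - c)) / 2"
    and g: "\<And>c. 0 \<le> g c" and t: "\<And>j. 1 \<le> t j" and i: "i < n"
  shows "rad_mean F n x v + (t i - 1) * g (x i) \<le> rad_mean F n (\<lambda>j. t j *\<^sub>R x j) v"
proof -
  have first: "rad_mean F n y (v + c) + rad_mean F n y (v - c) + 2 * (s - 1) * g c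
      \<le> rad_mean F n y (v + s *\<^sub>R c) + rad_mean F n y (v - s *\<^sub>R c)" if "1 \<le> s" for n y v c s
  proof -
    have "(s - 1) * (2 * (rad_mean F n y v + g c)) \<le> (s - 1) * (rad_mean F n y (v + c) + rad_mean F n y (v - c))"
      using that rad_mean_midpoint_gap[of F g n y v c, OF gap] by (intro mult_left_mono) auto
    then show ?thesis
      using convex_dilation_gap[OF convex_on_rad_mean[OF F] that, of n y v c]
      by (simp add: algebra_simps)
  qed
  have mono: "rad_mean F n x v \<le> rad_mean F n (\<lambda>j. t j *\<^sub>R x j) v"
    if "\<And>j. 1 \<le> t j" for n x v and t :: "nat \<Rightarrow> real"
    using that
  proof (induction n arbitrary: x v t)
    case (Suc n)
    let ?y = "\<lambda>j. t (Suc j) *\<^sub>R x (Suc j)"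
    have "rad_mean F n (\<lambda>j. x (Suc j)) u \<le> rad_mean F n ?y u" for u
      using Suc.IH[of "\<lambda>j. t (Suc j)" "\<lambda>j. x (Suc j)" u] Suc.prems by simp
    from this[of "v + x 0"] this[of "v - x 0"] first[OF Suc.prems[of 0], of n ?y v "x 0"]
    have "rad_mean F n (\<lambda>j. x (Suc j)) (v + x 0) + rad_mean F n (\<lambda>j. x (Suc j)) (v - x 0)
      \<le> rad_mean F n ?y (v + t 0 *\<^sub>R x 0) + rad_mean F n ?y (v - t 0 *\<^sub>R x 0)"
      using mult_nonneg_nonneg[of "t 0 - 1" "g (x 0)"] Suc.prems[of 0] g[of "x 0"]
      by (simp add: left_diff_distrib)
    then show ?case by simp
  qed simp
  show ?thesis
    using t i
  proof (induction n arbitrary: x v t i)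
    case (Suc n)
    let ?x = "\<lambda>j. x (Suc j)"
    let ?y = "\<lambda>j. t (Suc j) *\<^sub>R x (Suc j)"
    have t0: "0 \<le> (t 0 - 1) * g (x 0)"
      using Suc.prems(1)[of 0] g by simp
    note f = first[OF Suc.prems(1)[of 0], of n ?y v "x 0"]
    show ?case
    proof (cases i)
      case 0
      have "rad_mean F n ?x u \<le> rad_mean F n ?y u" for u
        using mono[of "\<lambda>j. t (Suc j)" n ?x u] Suc.prems by simp
      from this[of "v + x 0"] this[of "v - x 0"] f show ?thesis
        by (simp add: 0 field_simps)
    next
      case (Suc k)
      have "rad_mean F n ?x u + (t i - 1) * g (x i) \<le> rad_mean F n ?y u" for u
        using Suc.IH[of "\<lambda>j. t (Suc j)" k ?x u] Suc.prems Suc by simp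
      from this[of "v + x 0"] this[of "v - x 0"] f t0 show ?thesis
        by (simp add: field_simps)
    qed
  qed simp
qed

section \<open>Khintchine's inequality\<close>

lemma sum_atMost_even_odd:
  fixes f :: "nat \<Rightarrow> 'a::comm_monoid_add"
  shows "(\<Sum>i\<le>2 * k. f i) = (\<Sum>j\<le>k. f (2 * j)) + (\<Sum>j<k. f (2 * j + 1))"
  by (induction k) (simp_all add: ac_simps)

lemma power_add_power_diff_expansion:
  fixes a b :: real
  shows "(a + b) ^ n + (a - b) ^ n = (\<Sum>i\<le>n. real (n choose i) * a ^ (n - i) * (b ^ i + (- b) ^ i))"
proof -
  have "(a + c) ^ n = (\<Sum>i\<le>n. real (n choose i) * a ^ (n - i) * c ^ i)" for c
    using binomial_ring[of c a n] by (simp add: ac_simps)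
  from this[of b] this[of "- b"] show ?thesis
    by (simp add: sum.distrib[symmetric] algebra_simps)
qed

text \<open>
  For vectors \<open>u\<close> and \<open>c\<close> of given lengths the left side is largest when they are parallel, by the
  Cauchy--Schwarz inequality; the right side is its value in that case.
\<close>

lemma even_moment_step:
  fixes u c :: "'a::real_inner"
  shows "(norm (u + c) ^ (2 * k) + norm (u - c) ^ (2 * k)) / 2
    \<le> (\<Sum>j\<le>k. real (2 * k choose (2 * j)) * norm c ^ (2 * j) * norm u ^ (2 * (k - j)))"
proof -
  define p q where "p = norm u" and "q = norm c"
  have sq: "norm (u + c) ^ (2 * k) = (p\<^sup>2 + q\<^sup>2 + 2 * (u \<bullet> c)) ^ k"
    "norm (u - c) ^ (2 * k) = (p\<^sup>2 + q\<^sup>2 - 2 * (u \<bullet> c)) ^ k"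
    unfolding power_mult p_def q_def
    by (simp_all add: power2_norm_eq_inner inner_simps inner_commute ac_simps)
  have "(2 * (u \<bullet> c)) ^ i + (- (2 * (u \<bullet> c))) ^ i \<le> (2 * p * q) ^ i + (- (2 * p * q)) ^ i" for i
  proof (cases "even i")
    case True
    have "\<bar>2 * (u \<bullet> c)\<bar> \<le> 2 * p * q"
      using Cauchy_Schwarz_ineq2[of u c] by (simp add: p_def q_def abs_mult)
    then have "\<bar>2 * (u \<bullet> c)\<bar> ^ i \<le> (2 * p * q) ^ i"
      by (intro power_mono) auto
    then show ?thesis
      unfolding power_minus_even[OF True] power_even_abs[OF True] by linarith
  qed simp
  then have "norm (u + c) ^ (2 * k) + norm (u - c) ^ (2 * k)
      \<le> (p\<^sup>2 + q\<^sup>2 + 2 * p * q) ^ k + (p\<^sup>2 + q\<^sup>2 - 2 * p * q) ^ k"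
    unfolding sq power_add_power_diff_expansion
    by (intro sum_mono mult_left_mono) auto
  also have "\<dots> = (p + q) ^ (2 * k) + (p - q) ^ (2 * k)"
    by (simp add: power_mult power2_sum power2_diff)
  also have "\<dots> = 2 * (\<Sum>j\<le>k. real (2 * k choose (2 * j)) * q ^ (2 * j) * p ^ (2 * (k - j)))"
    unfolding power_add_power_diff_expansion sum_atMost_even_odd
    by (simp add: sum_distrib_left diff_mult_distrib diff_mult_distrib2 ac_simps)
  finally show ?thesis
    by (simp add: p_def q_def)
qed

text \<open>
  \<open>(2 k - 1)!!\<close>, the \<open>2 k\<close>-th moment of a standard Gaussian variable.
\<close>

definition gauss_moment :: "nat \<Rightarrow> real" where
  "gauss_moment k = fact (2 * k) / (2 ^ k * fact k)"

lemma gauss_moment_Suc: "gauss_moment (Suc k) = (2 * real k + 1) * gauss_moment k"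
proof -
  have "fact (2 * Suc k) = (2 * real k + 2) * ((2 * real k + 1) * fact (2 * k))"
    by (simp add: algebra_simps)
  moreover have "2 ^ Suc k * fact (Suc k) = (2 * real k + 2) * (2 ^ k * fact k)"
    by (simp add: algebra_simps)
  ultimately show ?thesis
    unfolding gauss_moment_def by (simp del: power_Suc fact_Suc)
qed

lemma gauss_moment_le: "1 \<le> k \<Longrightarrow> gauss_moment k \<le> (2 * real k - 1) ^ (k - 1)"
proof (induction k rule: dec_induct)
  case base
  then show ?case by (simp add: gauss_moment_def)
next
  case (step k)
  have "gauss_moment (Suc k) \<le> (2 * real k + 1) * (2 * real k - 1) ^ (k - 1)"
    unfolding gauss_moment_Suc using step by (intro mult_left_mono) auto
  also have "\<dots> \<le> (2 * real k + 1) * (2 * real k + 1) ^ (k - 1)"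
    using step by (intro mult_left_mono power_mono) auto
  also have "\<dots> = (2 * real (Suc k) - 1) ^ (Suc k - 1)"
    using step by (cases k) (auto simp: algebra_simps)
  finally show ?case .
qed

lemma two_power_fact_le: "2 ^ j * fact j \<le> (fact (2 * j) :: real)"
proof (induction j)
  case (Suc j)
  have "2 ^ Suc j * fact (Suc j) = (2 * real j + 2) * (2 ^ j * fact j)"
    by (simp add: algebra_simps)
  also have "\<dots> \<le> (2 * real j + 2) * ((2 * real j + 1) * fact (2 * j))"
    using Suc by (intro mult_left_mono order_trans[OF Suc]) (auto simp: algebra_simps)
  also have "\<dots> = fact (2 * Suc j)"
    by (simp add: algebra_simps)
  finally show ?case .
qed simp

lemma binomial_gauss_moment_le:
  assumes "j \<le> k"
  shows "real (2 * k choose (2 * j)) * gauss_moment (k - j) \<le> gauss_moment k * real (k choose j)"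
proof -
  have "real (2 * k choose (2 * j)) * gauss_moment (k - j)
      = fact (2 * k) / (2 ^ (k - j) * fact (k - j)) / fact (2 * j)"
    using assms by (simp add: binomial_fact gauss_moment_def diff_mult_distrib2)
  also have "\<dots> \<le> fact (2 * k) / (2 ^ (k - j) * fact (k - j)) / (2 ^ j * fact j)"
    by (intro divide_left_mono two_power_fact_le) auto
  also have "\<dots> = gauss_moment k * real (k choose j)"
    using assms by (simp add: binomial_fact gauss_moment_def field_simps flip: power_add)
  finally show ?thesis .
qed

text \<open>
  The even moments of sums of random signs are at most those of the Gaussian variable of the same variance:
  expand in the last summand and compare the result, coefficient by coefficient, with the
  binomial expansion of \<open>(Q + S) ^ k\<close>, where \<open>Q\<close> is the squared norm of the last coefficient
  and \<open>S\<close> the sum of the preceding ones.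
\<close>

lemma rad_mean_even_moment:
  fixes x :: "nat \<Rightarrow> 'a::real_inner"
  shows "rad_mean (\<lambda>u. norm u ^ (2 * k)) n x 0 \<le> gauss_moment k * (\<Sum>j<n. (norm (x j))\<^sup>2) ^ k"
proof (induction n arbitrary: k)
  case 0
  then show ?case
    by (cases k) (simp_all add: gauss_moment_def)
next
  case (Suc n)
  define S where "S = (\<Sum>j<n. (norm (x j))\<^sup>2)"
  let ?q = "(norm (x n))\<^sup>2"
  have S: "0 \<le> S"
    by (simp add: S_def sum_nonneg)
  have "rad_mean (\<lambda>u. norm u ^ (2 * k)) (Suc n) x 0
      \<le> rad_mean (\<lambda>u. \<Sum>j\<le>k. real (2 * k choose (2 * j)) * norm (x n) ^ (2 * j) * norm u ^ (2 * (k - j))) n x 0"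
    unfolding rad_mean_Suc_last by (intro rad_mean_mono even_moment_step)
  also have "\<dots> = (\<Sum>j\<le>k. real (2 * k choose (2 * j)) * ?q ^ j * rad_mean (\<lambda>u. norm u ^ (2 * (k - j))) n x 0)"
    by (simp only: rad_mean_sum rad_mean_cmult power_mult)
  also have "\<dots> \<le> (\<Sum>j\<le>k. real (2 * k choose (2 * j)) * ?q ^ j * (gauss_moment (k - j) * S ^ (k - j)))"
    unfolding S_def by (intro sum_mono mult_left_mono Suc) auto
  also have "\<dots> = (\<Sum>j\<le>k. (real (2 * k choose (2 * j)) * gauss_moment (k - j)) * (?q ^ j * S ^ (k - j)))"
    by (simp add: ac_simps)
  also have "\<dots> \<le> (\<Sum>j\<le>k. (gauss_moment k * real (k choose j)) * (?q ^ j * S ^ (k - j)))"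
    using S by (intro sum_mono mult_right_mono binomial_gauss_moment_le) auto
  also have "\<dots> = gauss_moment k * (?q + S) ^ k"
    unfolding binomial_ring by (simp add: sum_distrib_left ac_simps)
  finally show ?case
    by (simp add: S_def add.commute)
qed

text \<open>
  The moment of order \<open>r\<close> is interpolated between the second moment and the moment of order \<open>2 k\<close>,
  by the weighted arithmetic-geometric mean inequality under the average. The second moment has
  constant 1, which makes the bound for fixed \<open>k\<close> tend to 1 as \<open>r\<close> tends to 2.
\<close>

lemma khintchine:
  fixes x :: "nat \<Rightarrow> 'a::real_inner"
  assumes r: "2 < r" "r \<le> 2 * real k"
  shows "rad_mean (\<lambda>u. norm u powr r) n x 0
    \<le> (2 * real k - 1) powr ((r - 2) / 2) * (\<Sum>j<n. (norm (x j))\<^sup>2) powr (r / 2)"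
proof -
  define S where "S = (\<Sum>j<n. (norm (x j))\<^sup>2)"
  show ?thesis
  proof (cases "S = 0")
    case True
    then have "x j = 0" if "j < n" for j
      using that by (simp add: S_def sum_nonneg_eq_0_iff)
    then show ?thesis
      using r by (simp add: rad_mean_zero)
  next
    case False
    then have S: "0 < S"
      by (simp add: S_def sum_nonneg less_le)
    have k: "2 \<le> k" using r by auto
    \<comment> \<open>\<open>r = (1 - \<beta>) * 2 + \<beta> * (2 * k)\<close>, and \<open>M\<close> bounds the Gaussian moment of order \<open>2 * k\<close>.\<close>
    define \<beta> where "\<beta> = (r - 2) / (2 * real k - 2)"
    define B where "B = 2 * real k - 1"
    define M where "M = B ^ (k - 1)"
    have B: "0 < B" and M: "0 < M"
      using k by (simp_all add: B_def M_def)
    have \<beta>: "0 \<le> \<beta>" "\<beta> \<le> 1"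
      using r k by (simp_all add: \<beta>_def)
    have expo: "(1 - \<beta>) + real k * \<beta> = r / 2"
    proof -
      have "(real k - 1) * \<beta> = (r - 2) / 2"
        using k by (simp add: \<beta>_def field_simps)
      then show ?thesis by (simp add: algebra_simps)
    qed
    have M\<beta>: "M powr \<beta> = B powr ((r - 2) / 2)"
    proof -
      have "M powr \<beta> = B powr (real (k - 1) * \<beta>)"
        unfolding M_def using B by (simp add: powr_powr flip: powr_realpow)
      also have "real (k - 1) * \<beta> = (r - 2) / 2"
        using k by (simp add: \<beta>_def field_simps of_nat_diff)
      finally show ?thesis .
    qed
    have pointwise: "norm u powr r \<le> M powr \<beta> * S powr (r / 2) *
        ((1 - \<beta>) / S * norm u ^ (2 * 1) + \<beta> / (M * S ^ k) * norm u ^ (2 * k))" for u :: 'a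
    proof (cases "u = 0")
      case False
      define y where "y = (norm u)\<^sup>2 / S"
      have y: "0 < y" using False S by (simp add: y_def)
      have "y powr (r / 2) = y powr (1 - \<beta>) * (y ^ k) powr \<beta>"
        using y by (simp add: powr_powr flip: expo powr_realpow powr_add)
      also have "\<dots> = M powr \<beta> * (y powr (1 - \<beta>) * (y ^ k / M) powr \<beta>)"
        using M y by (simp add: powr_divide)
      also have "\<dots> \<le> M powr \<beta> * ((1 - \<beta>) * y + \<beta> * (y ^ k / M))"
        using \<beta> y M by (intro mult_left_mono Youngs_inequality_0) auto
      finally have "S powr (r / 2) * y powr (r / 2) \<le> S powr (r / 2) * (M powr \<beta> * ((1 - \<beta>) * y + \<beta> * (y ^ k / M)))"
        by (intro mult_left_mono) auto
      moreover have "S powr (r / 2) * y powr (r / 2) = norm u powr r"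
        using S False by (simp add: y_def powr_powr flip: powr_mult powr_numeral)
      moreover have "(1 - \<beta>) * y + \<beta> * (y ^ k / M) =
          (1 - \<beta>) / S * norm u ^ (2 * 1) + \<beta> / (M * S ^ k) * norm u ^ (2 * k)"
        by (simp add: y_def power_divide flip: power_mult)
      ultimately show ?thesis
        by (simp only: mult_ac)
    qed (use k in \<open>simp add: zero_power\<close>)
    have "rad_mean (\<lambda>u. norm u powr r) n x 0 \<le> M powr \<beta> * S powr (r / 2) *
        ((1 - \<beta>) / S * rad_mean (\<lambda>u. norm u ^ (2 * 1)) n x 0
          + \<beta> / (M * S ^ k) * rad_mean (\<lambda>u. norm u ^ (2 * k)) n x 0)"
      unfolding rad_mean_cmult[symmetric] rad_mean_add[symmetric]
      by (intro rad_mean_mono pointwise)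
    also have "\<dots> \<le> M powr \<beta> * S powr (r / 2) * ((1 - \<beta>) / S * S + \<beta> / (M * S ^ k) * (M * S ^ k))"
    proof (intro mult_left_mono add_mono)
      show "rad_mean (\<lambda>u. norm u ^ (2 * 1)) n x 0 \<le> S"
        using rad_mean_even_moment[of 1 n x] by (simp add: S_def gauss_moment_def)
      have "gauss_moment k * S ^ k \<le> M * S ^ k"
        using gauss_moment_le[of k] k S by (intro mult_right_mono) (auto simp: M_def B_def)
      then show "rad_mean (\<lambda>u. norm u ^ (2 * k)) n x 0 \<le> M * S ^ k"
        using rad_mean_even_moment[of k n x] by (simp add: S_def)
    qed (use S M \<beta> in auto)
    also have "\<dots> = M powr \<beta> * S powr (r / 2)"
      using S M by simp
    finally show ?thesis
      by (simp add: M\<beta> S_def B_def)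
  qed
qed

section \<open>The choice of the constant\<close>

text \<open>
  As \<open>s\<close> tends to 0, the right side is \<open>1 + r (r - 1) s\<^sup>2 / 2\<close> and the left side is
  \<open>1 + r D s\<^sup>2 / 2\<close> up to higher order.
\<close>

lemma two_point_gain:
  fixes D r :: real
  assumes "0 < D" "D < r - 1" "2 < r"
  obtains s where "0 < s" "s < 1"
    "(1 + D * s\<^sup>2) powr (r / 2) < ((1 + s) powr r + (1 - s) powr r) / 2"
proof -
  let ?f = "\<lambda>s::real. (((1 + s) powr r + (1 - s) powr r) / 2 - (1 + D * s\<^sup>2) powr (r / 2)) / s\<^sup>2"
  have "(?f \<longlongrightarrow> r * (r - 1 - D) / 2) (at_right 0)"
    using assms by (real_asymp simp: field_simps)
  moreover have "0 < r * (r - 1 - D) / 2"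
    using assms by simp
  ultimately have "eventually (\<lambda>s. 0 < ?f s) (at_right 0)"
    by (rule order_tendstoD)
  moreover have "eventually (\<lambda>s::real. 0 < s \<and> s < 1) (at_right 0)"
    by (auto simp: eventually_at_right_field intro!: exI[of _ 1])
  ultimately have "eventually (\<lambda>s. 0 < ?f s \<and> 0 < s \<and> s < 1) (at_right 0)"
    by (rule eventually_conj)
  then obtain s where "0 < ?f s" "0 < s" "s < 1"
    using eventually_happens'[OF trivial_limit_at_right_real] by blast
  then show ?thesis
    by (intro that[of s]) (auto simp: zero_less_divide_iff)
qed

text \<open>
  With \<open>2 k\<close> the least even integer that is at least \<open>r\<close>, the number \<open>B = 2 k - 1\<close> is less than
  \<open>r + 1\<close>, and Bernoulli's inequality gives
  \<open>C\<^sup>2 = B powr ((r - 2) / r) < (1 + r) powr ((r - 2) / r) \<le> 1 + (r - 2) = r - 1\<close>.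
\<close>

lemma khintchine_constant:
  fixes r :: real
  assumes "2 < r"
  obtains C where "0 < C" "C\<^sup>2 < r - 1"
    "\<And>(x :: nat \<Rightarrow> 'a::real_inner) n. rad_mean (\<lambda>u. norm u powr r) n x 0 \<le> (C * sqrt (\<Sum>j<n. (norm (x j))\<^sup>2)) powr r"
proof -
  define k where "k = nat \<lceil>r / 2\<rceil>"
  have k: "r \<le> 2 * real k" "2 * real k < r + 2"
    unfolding k_def using assms by linarith+
  define B where "B = 2 * real k - 1"
  define C where "C = B powr ((r - 2) / (2 * r))"
  have B: "1 < B" "B < r + 1"
    using k assms by (auto simp: B_def)
  have u: "0 < (r - 2) / r" "(r - 2) / r < 1"
    using assms by auto
  have "(r - 2) / (2 * r) + (r - 2) / (2 * r) = (r - 2) / r"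
    using assms by (simp add: field_simps)
  then have "C\<^sup>2 = B powr ((r - 2) / r)"
    unfolding C_def power2_eq_square powr_add[symmetric] by simp
  also have "\<dots> < (1 + r) powr ((r - 2) / r)"
    using B u by (intro powr_less_mono2) auto
  also have "\<dots> = (1 + r) powr ((r - 2) / r) * 1 powr (1 - (r - 2) / r)"
    by simp
  \<comment> \<open>Bernoulli's inequality, as an instance of Young's.\<close>
  also have "\<dots> \<le> (r - 2) / r * (1 + r) + (1 - (r - 2) / r) * 1"
    using u assms by (intro Youngs_inequality_0) auto
  also have "\<dots> = r - 1"
    using assms by (simp add: field_simps)
  finally have "C\<^sup>2 < r - 1" .
  moreover have "0 < C"
    using B by (simp add: C_def)
  moreover have "rad_mean (\<lambda>u. norm u powr r) n x 0 \<le> (C * sqrt (\<Sum>j<n. (norm (x j))\<^sup>2)) powr r" for x :: "nat \<Rightarrow> 'a" and n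
  proof -
    have "(C * sqrt (\<Sum>j<n. (norm (x j))\<^sup>2)) powr r = B powr ((r - 2) / 2) * (\<Sum>j<n. (norm (x j))\<^sup>2) powr (r / 2)"
      using \<open>0 < C\<close> assms
      by (simp add: C_def powr_mult powr_powr sum_nonneg flip: powr_half_sqrt)
    then show ?thesis
      using khintchine[OF assms k(1), of n x] by (simp add: B_def)
  qed
  ultimately show ?thesis
    using that by blast
qed

section \<open>The Rademacher functions\<close>

definition rademacher :: "nat \<Rightarrow> real \<Rightarrow> real" where
  "rademacher n t = (if even \<lfloor>2 ^ (n + 1) * t\<rfloor> then 1 else - 1)"

lemma rademacher_double: "rademacher (Suc n) t = rademacher n (2 * t)"
  by (simp add: rademacher_def ac_simps)

lemma rademacher_period: "rademacher n (t - 1) = rademacher n t"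
proof -
  have "\<lfloor>2 ^ (n + 1) * (t - 1)\<rfloor> = \<lfloor>2 ^ (n + 1) * t - of_int (2 ^ (n + 1))\<rfloor>"
    by (simp add: algebra_simps)
  also have "\<dots> = \<lfloor>2 ^ (n + 1) * t\<rfloor> - 2 ^ (n + 1)"
    by (rule floor_diff_of_int)
  finally show ?thesis
    by (simp add: rademacher_def)
qed

lemma borel_measurable_rademacher [measurable]: "rademacher n \<in> borel_measurable borel"
  unfolding rademacher_def by measurable

text \<open>
  On each half of the unit interval \<open>\<epsilon>\<^sub>0\<close> is constant, and \<open>t \<mapsto> 2 t\<close> or \<open>t \<mapsto> 2 t - 1\<close> maps
  this half onto the whole interval and \<open>\<epsilon>\<^sub>j\<^sub>+\<^sub>1\<close> to \<open>\<epsilon>\<^sub>j\<close>; this turns the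
  recursion of the averages into a substitution in the integral.
\<close>

lemma has_integral_rademacher_sum:
  fixes F :: "'a::real_normed_vector \<Rightarrow> real"
  shows "((\<lambda>t. F (v + (\<Sum>j<n. rademacher j t *\<^sub>R x j))) has_integral rad_mean F n x v) {0..1}"
proof (induction n arbitrary: x v)
  case 0
  then show ?case
    using has_integral_const_real[of "F v" 0 1] by simp
next
  case (Suc n)
  let ?x = "\<lambda>j. x (Suc j)"
  let ?g = "\<lambda>w u. F (w + (\<Sum>j<n. rademacher j u *\<^sub>R ?x j))"
  let ?f = "\<lambda>t. F (v + (\<Sum>j<Suc n. rademacher j t *\<^sub>R x j))"
  have split: "?f t = ?g (v + rademacher 0 t *\<^sub>R x 0) (2 * t)" for t
    by (simp add: sum.lessThan_Suc_shift rademacher_double add.assoc del: sum.lessThan_Suc)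
  have left: "((\<lambda>t. ?g (v + x 0) (2 * t)) has_integral rad_mean F n ?x (v + x 0) / 2) {0..1/2}"
    using has_integral_affinity'[of "?g (v + x 0)" _ 0 1 2 0] Suc[of "v + x 0" ?x] by simp
  have right: "((\<lambda>t. ?g (v - x 0) (2 * t)) has_integral rad_mean F n ?x (v - x 0) / 2) {1/2..1}"
    using has_integral_affinity'[of "?g (v - x 0)" _ 0 1 2 "-1"] Suc[of "v - x 0" ?x]
    by (simp add: rademacher_period)
  have "(?f has_integral rad_mean F n ?x (v + x 0) / 2) {0..1/2}"
  proof (rule has_integral_spike_finite[OF _ _ left])
    fix t :: real assume t: "t \<in> {0..1/2} - {1/2}"
    then have "\<lfloor>2 * t\<rfloor> = 0" by (auto simp: floor_eq_iff)
    then have "rademacher 0 t = 1" by (simp add: rademacher_def)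
    then show "?f t = ?g (v + x 0) (2 * t)" unfolding split by simp
  qed simp
  moreover have "(?f has_integral rad_mean F n ?x (v - x 0) / 2) {1/2..1}"
  proof (rule has_integral_spike_finite[OF _ _ right])
    fix t :: real assume t: "t \<in> {1/2..1} - {1}"
    then have "\<lfloor>2 * t\<rfloor> = 1" by (auto simp: floor_eq_iff)
    then have "rademacher 0 t = - 1" by (simp add: rademacher_def)
    then show "?f t = ?g (v - x 0) (2 * t)" unfolding split by simp
  qed simp
  ultimately have "(?f has_integral rad_mean F n ?x (v + x 0) / 2 + rad_mean F n ?x (v - x 0) / 2) {0..1}"
    by (intro has_integral_combine[where c = "1/2"]) auto
  then show ?case
    by (simp add: add_divide_distrib)
qed

section \<open>The Lebesgue spaces\<close>

text \<open>
  For \<open>a\<close> and \<open>b\<close> larger than the two norms, write \<open>norm (f t) + norm (g t)\<close> as \<open>a + b\<close> times a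
  convex combination of \<open>norm (f t) / a\<close> and \<open>norm (g t) / b\<close>, and integrate the convexity
  inequality of the power. Working with \<open>a\<close> and \<open>b\<close> avoids a case distinction on vanishing norms.
\<close>

lemma minkowski_inequality:
  fixes f g :: "'a \<Rightarrow> 'b::{real_normed_vector, second_countable_topology}"
  assumes r: "1 \<le> r" and [measurable]: "f \<in> borel_measurable M" "g \<in> borel_measurable M"
    and f: "integrable M (\<lambda>t. norm (f t) powr r)" and g: "integrable M (\<lambda>t. norm (g t) powr r)"
  shows "integrable M (\<lambda>t. norm (f t + g t) powr r)"
    and "(LINT t|M. norm (f t + g t) powr r) powr (1 / r)
      \<le> (LINT t|M. norm (f t) powr r) powr (1 / r) + (LINT t|M. norm (g t) powr r) powr (1 / r)"
proof -
  have pointwise: "norm (f t + g t) powr r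
      \<le> (a + b) powr r * (a / (a + b) / a powr r * norm (f t) powr r + b / (a + b) / b powr r * norm (g t) powr r)"
    if ab: "0 < a" "0 < b" for a b t
  proof -
    have w: "1 - b / (a + b) = a / (a + b)"
      using ab by (simp add: field_simps)
    have "norm (f t + g t) powr r \<le> (norm (f t) + norm (g t)) powr r"
      using r by (intro powr_mono2 norm_triangle_ineq) auto
    also have "norm (f t) + norm (g t) = (a + b) * ((1 - b / (a + b)) *\<^sub>R (norm (f t) / a) + (b / (a + b)) *\<^sub>R (norm (g t) / b))"
      using ab by (simp add: w distrib_left)
    also have "\<dots> powr r = (a + b) powr r * ((1 - b / (a + b)) *\<^sub>R (norm (f t) / a) + (b / (a + b)) *\<^sub>R (norm (g t) / b)) powr r"
      by (rule powr_mult)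
    also have "\<dots> \<le> (a + b) powr r * ((1 - b / (a + b)) * (norm (f t) / a) powr r + (b / (a + b)) * (norm (g t) / b) powr r)"
      using ab r by (intro mult_left_mono convex_onD[OF convex_on_powr_nonneg]) auto
    finally show ?thesis
      unfolding w using ab by (simp add: powr_divide)
  qed
  show int: "integrable M (\<lambda>t. norm (f t + g t) powr r)"
  proof (rule Bochner_Integration.integrable_bound)
    show "integrable M (\<lambda>t. (1 + 1) powr r * (1 / (1 + 1) / 1 powr r * norm (f t) powr r
        + 1 / (1 + 1) / 1 powr r * norm (g t) powr r))"
      using f g by simp
    show "AE t in M. norm (norm (f t + g t) powr r) \<le> norm ((1 + 1) powr r * (1 / (1 + 1) / 1 powr r * norm (f t) powr r
        + 1 / (1 + 1) / 1 powr r * norm (g t) powr r))"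
      using pointwise[of 1 1] by (intro AE_I2) (simp add: abs_of_nonneg)
  qed simp
  define A B where "A = (LINT t|M. norm (f t) powr r) powr (1 / r)" "B = (LINT t|M. norm (g t) powr r) powr (1 / r)"
  have AB: "0 \<le> A" "0 \<le> B"
    "A powr r = (LINT t|M. norm (f t) powr r)" "B powr r = (LINT t|M. norm (g t) powr r)"
    using r by (simp_all add: A_B_def powr_powr)
  have "(LINT t|M. norm (f t + g t) powr r) powr (1 / r) \<le> A + B + e" if e: "0 < e" for e
  proof -
    define a b where "a = A + e / 2" "b = B + e / 2"
    have ab: "0 < a" "0 < b" "A \<le> a" "B \<le> b"
      using AB e by (simp_all add: a_b_def)
    have "(LINT t|M. norm (f t + g t) powr r)
      \<le> (LINT t|M. (a + b) powr r * (a / (a + b) / a powr r * norm (f t) powr r + b / (a + b) / b powr r * norm (g t) powr r))"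
      using f g int by (intro integral_mono pointwise ab) auto
    also have "\<dots> = (a + b) powr r * (a / (a + b) / a powr r * A powr r + b / (a + b) / b powr r * B powr r)"
      using f g by (simp add: AB)
    also have "\<dots> \<le> (a + b) powr r * (a / (a + b) / a powr r * a powr r + b / (a + b) / b powr r * b powr r)"
      using ab AB r by (intro mult_left_mono add_mono powr_mono2) auto
    also have "\<dots> = (a + b) powr r"
      using ab by (simp flip: add_divide_distrib)
    finally have "(LINT t|M. norm (f t + g t) powr r) powr (1 / r) \<le> ((a + b) powr r) powr (1 / r)"
      using r by (intro powr_mono2) auto
    then show ?thesis
      using r ab by (simp add: powr_powr a_b_def)
  qed
  then show "(LINT t|M. norm (f t + g t) powr r) powr (1 / r)
      \<le> (LINT t|M. norm (f t) powr r) powr (1 / r) + (LINT t|M. norm (g t) powr r) powr (1 / r)"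
    unfolding A_B_def[symmetric] by (rule field_le_epsilon)
qed

text \<open>
  A rapidly convergent subsequence has increments that are absolutely summable almost everywhere;
  its pointwise limit is the limit in \<open>L\<^sub>r\<close>, by Fatou's lemma.
\<close>

lemma riesz_fischer:
  fixes f :: "nat \<Rightarrow> 'a \<Rightarrow> 'b::{banach, second_countable_topology}"
  assumes M: "finite_measure M" and r: "1 \<le> r"
    and meas [measurable]: "\<And>n. f n \<in> borel_measurable M"
    and int: "\<And>m n. integrable M (\<lambda>t. norm (f m t - f n t) powr r)"
    and Cauchy: "\<And>e. 0 < e \<Longrightarrow> \<exists>N. \<forall>m\<ge>N. \<forall>n\<ge>N. (LINT t|M. norm (f m t - f n t) powr r) < e"
  obtains g where "g \<in> borel_measurable M" "\<And>n. integrable M (\<lambda>t. norm (g t - f n t) powr r)"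
    "(\<lambda>n. LINT t|M. norm (g t - f n t) powr r) \<longlonglongrightarrow> 0"
proof -
  interpret finite_measure M by (rule M)
  have "\<forall>k. \<exists>N. \<forall>m\<ge>N. \<forall>n\<ge>N. (LINT t|M. norm (f m t - f n t) powr r) < ((1/2) ^ k) powr r"
    by (intro allI Cauchy) simp
  then obtain N where N: "\<And>k m n. N k \<le> m \<Longrightarrow> N k \<le> n \<Longrightarrow> (LINT t|M. norm (f m t - f n t) powr r) < ((1/2) ^ k) powr r"
    by metis
  define s where "s k = (\<Sum>i\<le>k. N i + 1)" for k
  have sN: "N k \<le> s k" "k < s k" for k
    by (induction k) (auto simp: s_def)
  have sN': "N k \<le> s (Suc k)" for k
    using sN(1)[of k] by (simp add: s_def)
  define d where "d k t = f (s (Suc k)) t - f (s k) t" for k t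
  have [measurable]: "d k \<in> borel_measurable M" for k
    unfolding d_def by measurable
  \<comment> \<open>On a finite measure space this bounds the first moment by the one of order \<open>r\<close>: where the
    increment is not small, \<open>norm (d k t) powr (1 - r)\<close> is at most \<open>((1/2) ^ k) powr (1 - r)\<close>.\<close>
  have d_pointwise: "norm (d k t) \<le> (1/2) ^ k + ((1/2) ^ k) powr (1 - r) * norm (d k t) powr r" for k t
  proof (cases "norm (d k t) \<le> (1/2) ^ k")
    case False
    then have pos: "0 < norm (d k t)"
      by (meson less_trans not_le zero_less_divide_1_iff zero_less_numeral zero_less_power)
    then have "norm (d k t) = norm (d k t) powr (1 - r) * norm (d k t) powr r"
      by (simp flip: powr_add)
    also have "\<dots> \<le> ((1/2) ^ k) powr (1 - r) * norm (d k t) powr r"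
      using False r by (intro mult_right_mono powr_mono2') auto
    finally show ?thesis
      by (rule order_trans) simp
  qed (auto intro: order_trans)
  have d_int: "integrable M (\<lambda>t. norm (d k t) powr r)" for k
    unfolding d_def by (rule int)
  have d_norm_int: "integrable M (\<lambda>t. norm (d k t))" for k
  proof (rule Bochner_Integration.integrable_bound)
    show "integrable M (\<lambda>t. (1/2) ^ k + ((1/2) ^ k) powr (1 - r) * norm (d k t) powr r)"
      using d_int by simp
  qed (use d_pointwise in auto)
  have d_bound: "(LINT t|M. norm (d k t)) \<le> (measure M (space M) + 1) * (1/2) ^ k" for k
  proof -
    have "(LINT t|M. norm (d k t)) \<le> (LINT t|M. (1/2) ^ k + ((1/2) ^ k) powr (1 - r) * norm (d k t) powr r)"
      using d_int d_norm_int by (intro integral_mono d_pointwise) auto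
    also have "\<dots> = measure M (space M) * (1/2) ^ k + ((1/2) ^ k) powr (1 - r) * (LINT t|M. norm (d k t) powr r)"
      using d_int by simp
    also have "\<dots> \<le> measure M (space M) * (1/2) ^ k + ((1/2) ^ k) powr (1 - r) * ((1/2) ^ k) powr r"
      using N[of k "s (Suc k)" "s k"] sN sN' unfolding d_def
      by (intro add_left_mono mult_left_mono) (auto intro: less_imp_le)
    also have "\<dots> = (measure M (space M) + 1) * (1/2) ^ k"
      by (simp add: distrib_right flip: powr_add)
    finally show ?thesis .
  qed
  have summable_d: "summable (\<lambda>k. (measure M (space M) + 1) * (1/2) ^ k :: real)"
    by (intro summable_mult summable_geometric) simp
  have "(\<integral>\<^sup>+t. (\<Sum>k. ennreal (norm (d k t))) \<partial>M) = (\<Sum>k. \<integral>\<^sup>+t. ennreal (norm (d k t)) \<partial>M)"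
    by (intro nn_integral_suminf) measurable
  also have "\<dots> = (\<Sum>k. ennreal (LINT t|M. norm (d k t)))"
    using d_norm_int by (simp add: nn_integral_eq_integral)
  also have "\<dots> \<le> (\<Sum>k. ennreal ((measure M (space M) + 1) * (1/2) ^ k))"
    using d_bound by (intro suminf_le ennreal_leI) auto
  also have "\<dots> = ennreal (\<Sum>k. (measure M (space M) + 1) * (1/2) ^ k)"
    using summable_d by (intro suminf_ennreal2) auto
  finally have "(\<integral>\<^sup>+t. (\<Sum>k. ennreal (norm (d k t))) \<partial>M) < \<infinity>"
    by (rule le_less_trans) simp
  then have "(\<integral>\<^sup>+t. (\<Sum>k. ennreal (norm (d k t))) \<partial>M) \<noteq> \<infinity>"
    by simp
  then have "AE t in M. (\<Sum>k. ennreal (norm (d k t))) \<noteq> \<infinity>"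
    by (intro nn_integral_PInf_AE) measurable
  then have AE_conv: "AE t in M. convergent (\<lambda>k. f (s k) t)"
  proof eventually_elim
    case (elim t)
    have "summable (\<lambda>k. norm (d k t))"
      using elim by (intro summable_suminf_not_top) auto
    then have "convergent (\<lambda>n. \<Sum>k<n. d k t)"
      by (simp add: summable_norm_cancel flip: summable_iff_convergent)
    then have "convergent (\<lambda>n. (\<Sum>k<n. d k t) + f (s 0) t)"
      by (intro convergent_add convergent_const)
    moreover have "(\<Sum>k<n. d k t) + f (s 0) t = f (s n) t" for n
      unfolding d_def by (subst sum_lessThan_telescope) simp
    ultimately show ?case by simp
  qed
  define g where "g t = lim (\<lambda>k. f (s k) t)" for t
  have g [measurable]: "g \<in> borel_measurable M"
    unfolding g_def by measurable
  have fatou: "(\<integral>\<^sup>+t. ennreal (norm (g t - f n t) powr r) \<partial>M) \<le> ennreal c"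
    if c: "\<And>m. m \<ge> L \<Longrightarrow> (LINT t|M. norm (f m t - f n t) powr r) \<le> c" for n L c
  proof -
    have "(\<integral>\<^sup>+t. ennreal (norm (g t - f n t) powr r) \<partial>M)
      = (\<integral>\<^sup>+t. liminf (\<lambda>k. ennreal (norm (f (s k) t - f n t) powr r)) \<partial>M)"
    proof (rule nn_integral_cong_AE)
      show "AE t in M. ennreal (norm (g t - f n t) powr r) = liminf (\<lambda>k. ennreal (norm (f (s k) t - f n t) powr r))"
        using AE_conv
      proof eventually_elim
        case (elim t)
        have "(\<lambda>k. ennreal (norm (f (s k) t - f n t) powr r)) \<longlonglongrightarrow> ennreal (norm (g t - f n t) powr r)"
          using elim r unfolding g_def convergent_LIMSEQ_iff
          by (intro tendsto_ennrealI tendsto_powr2 tendsto_intros) auto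
        then show ?case
          by (intro lim_imp_Liminf[symmetric]) auto
      qed
    qed
    also have "\<dots> \<le> liminf (\<lambda>k. \<integral>\<^sup>+t. ennreal (norm (f (s k) t - f n t) powr r) \<partial>M)"
      by (intro nn_integral_liminf) measurable
    also have "\<dots> = liminf (\<lambda>k. ennreal (LINT t|M. norm (f (s k) t - f n t) powr r))"
      using int by (simp add: nn_integral_eq_integral)
    also have "\<dots> \<le> liminf (\<lambda>k::nat. ennreal c)"
    proof (rule Liminf_mono)
      show "eventually (\<lambda>k. ennreal (LINT t|M. norm (f (s k) t - f n t) powr r) \<le> ennreal c) sequentially"
        using eventually_ge_at_top[of L]
      proof eventually_elim
        case (elim k)
        then show ?case
          using sN(2)[of k] by (intro ennreal_leI c) simp
      qed
    qed
    also have "\<dots> = ennreal c"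
      by (simp add: Liminf_const)
    finally show ?thesis .
  qed
  have g_int: "integrable M (\<lambda>t. norm (g t - f n t) powr r)" for n
  proof -
    obtain N1 where N1: "\<And>m k. m \<ge> N1 \<Longrightarrow> k \<ge> N1 \<Longrightarrow> (LINT t|M. norm (f m t - f k t) powr r) < 1"
      using Cauchy[of 1] by auto
    have "(\<integral>\<^sup>+t. ennreal (norm (g t - f N1 t) powr r) \<partial>M) \<le> ennreal 1"
      using N1 by (intro fatou[of N1]) (auto intro: less_imp_le)
    then have "integrable M (\<lambda>t. norm (g t - f N1 t) powr r)"
      by (intro integrableI_bounded) (auto intro: le_less_trans)
    from minkowski_inequality(1)[OF r _ _ this int[of N1 n]] show ?thesis
      by simp
  qed
  have "(\<lambda>n. LINT t|M. norm (g t - f n t) powr r) \<longlonglongrightarrow> 0"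
  proof (rule LIMSEQ_I)
    fix e :: real assume e: "0 < e"
    obtain L where L: "\<And>m k. m \<ge> L \<Longrightarrow> k \<ge> L \<Longrightarrow> (LINT t|M. norm (f m t - f k t) powr r) < e / 2"
      using Cauchy[of "e / 2"] e by auto
    have "(LINT t|M. norm (g t - f n t) powr r) \<le> e / 2" if n: "n \<ge> L" for n
    proof -
      have "ennreal (LINT t|M. norm (g t - f n t) powr r) \<le> ennreal (e / 2)"
        using fatou[of L n "e / 2"] L n g_int[of n] by (simp add: nn_integral_eq_integral less_imp_le)
      then show ?thesis
        using e by simp
    qed
    then show "\<exists>no. \<forall>n\<ge>no. norm ((LINT t|M. norm (g t - f n t) powr r) - 0) < e"
      using e by (intro exI[of _ L] allI impI) (fastforce simp: integral_nonneg abs_of_nonneg)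
  qed
  with g g_int show ?thesis
    by (rule that)
qed

lemma in_Lebesgue_scale: "in_Lebesgue r f \<Longrightarrow> in_Lebesgue r (scale_ae_fun c f)"
  by transfer (auto simp: norm_mult powr_mult)

lemma Lebesgue_norm_scale:
  "0 < r \<Longrightarrow> Lebesgue_norm r (scale_ae_fun c f) = norm c * Lebesgue_norm r f"
  by transfer (auto simp: norm_mult powr_mult integral_nonneg powr_powr)

lemma Lebesgue_norm_nonneg: "0 \<le> Lebesgue_norm r f"
  by transfer simp

lemma in_Lebesgue_add: "1 \<le> r \<Longrightarrow> in_Lebesgue r f \<Longrightarrow> in_Lebesgue r g \<Longrightarrow> in_Lebesgue r (f + g)"
  by transfer (auto simp: ae_eq_def intro: minkowski_inequality)

lemma Lebesgue_norm_triangle: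
  "1 \<le> r \<Longrightarrow> in_Lebesgue r f \<Longrightarrow> in_Lebesgue r g \<Longrightarrow>
    Lebesgue_norm r (f + g) \<le> Lebesgue_norm r f + Lebesgue_norm r g"
  by transfer (auto simp: ae_eq_def intro: minkowski_inequality)

lemma in_Lebesgue_uminus: "in_Lebesgue r f \<Longrightarrow> in_Lebesgue r (- f)"
  by transfer simp

lemma in_Lebesgue_diff: "1 \<le> r \<Longrightarrow> in_Lebesgue r f \<Longrightarrow> in_Lebesgue r g \<Longrightarrow> in_Lebesgue r (f - g)"
  using in_Lebesgue_add[of r f "- g"] in_Lebesgue_uminus[of r g] by simp

lemma Lebesgue_norm_minus_commute: "Lebesgue_norm r (f - g) = Lebesgue_norm r (g - f)"
  by transfer (simp add: norm_minus_commute)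

lemma Lebesgue_norm_eq_0_iff:
  assumes "0 < r" "in_Lebesgue r f"
  shows "Lebesgue_norm r f = 0 \<longleftrightarrow> f = 0"
  using assms
proof transfer
  fix r :: real and f :: "real \<Rightarrow> 'a"
  assume r: "0 < r" and f: "ae_eq f f" and int: "integrable unit_interval_measure (\<lambda>t. norm (f t) powr r)"
  have "(LINT t|unit_interval_measure. norm (f t) powr r) powr (1 / r) = 0
      \<longleftrightarrow> (AE t in unit_interval_measure. norm (f t) powr r = 0)"
    using integral_nonneg_eq_0_iff_AE[OF int] by simp
  also have "\<dots> \<longleftrightarrow> ae_eq f (\<lambda>_. 0)"
    using f by (simp add: ae_eq_def)
  finally show "(LINT t|unit_interval_measure. norm (f t) powr r) powr (1 / r) = 0 \<longleftrightarrow> ae_eq f (\<lambda>_. 0)" .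
qed

lemma Metric_space_Lebesgue:
  assumes "1 \<le> r"
  shows "Metric_space {f. in_Lebesgue r f} (\<lambda>f g. Lebesgue_norm r (f - g))"
proof
  fix f g h :: "'a ae_fun"
  show "0 \<le> Lebesgue_norm r (f - g)"
    by (rule Lebesgue_norm_nonneg)
  show "Lebesgue_norm r (f - g) = Lebesgue_norm r (g - f)"
    by (rule Lebesgue_norm_minus_commute)
  assume f: "f \<in> {f. in_Lebesgue r f}" and g: "g \<in> {f. in_Lebesgue r f}"
  then have fg: "in_Lebesgue r (f - g)"
    using in_Lebesgue_diff[OF assms] by simp
  then show "Lebesgue_norm r (f - g) = 0 \<longleftrightarrow> f = g"
    using Lebesgue_norm_eq_0_iff[of r "f - g"] assms by simp
  assume "h \<in> {f. in_Lebesgue r f}"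
  then have "in_Lebesgue r (g - h)"
    using g in_Lebesgue_diff[OF assms] by simp
  then show "Lebesgue_norm r (f - h) \<le> Lebesgue_norm r (f - g) + Lebesgue_norm r (g - h)"
    using Lebesgue_norm_triangle[OF assms fg, of "g - h"] by simp
qed

lemma Lebesgue_complete:
  fixes f :: "nat \<Rightarrow> 'k::{real_normed_field, banach, second_countable_topology} ae_fun"
  assumes r: "1 \<le> r" and f: "\<And>n. in_Lebesgue r (f n)"
    and Cauchy: "\<And>e. 0 < e \<Longrightarrow> \<exists>N. \<forall>m\<ge>N. \<forall>n\<ge>N. Lebesgue_norm r (f m - f n) < e"
  obtains F where "in_Lebesgue r F" "(\<lambda>n. Lebesgue_norm r (F - f n)) \<longlonglongrightarrow> 0"
proof -
  define h where "h n = rep_ae_fun (f n)" for n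
  have h: "ae_eq (h n) (h n)" "f n = abs_ae_fun (h n)" for n
    by (simp_all add: h_def Quotient_rep_reflp[OF Quotient_ae_fun] Quotient_abs_rep[OF Quotient_ae_fun])
  have meas [measurable]: "h n \<in> borel_measurable unit_interval_measure" for n
    using h(1) by (simp add: ae_eq_def)
  have diff: "ae_eq (\<lambda>t. g t - h n t) (\<lambda>t. g t - h n t)"
      "abs_ae_fun g - f n = abs_ae_fun (\<lambda>t. g t - h n t)" if "ae_eq g g" for g n
    using that h minus_ae_fun.abs_eq[of g "h n"] by (auto simp: ae_eq_def)
  have in_L: "in_Lebesgue r (abs_ae_fun g - f n) \<longleftrightarrow> integrable unit_interval_measure (\<lambda>t. norm (g t - h n t) powr r)"
    if "ae_eq g g" for g n
    using in_Lebesgue.abs_eq[OF diff(1)[OF that]] diff(2)[OF that] by simp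
  have norm_L: "Lebesgue_norm r (abs_ae_fun g - f n)
      = (LINT t|unit_interval_measure. norm (g t - h n t) powr r) powr (1 / r)" if "ae_eq g g" for g n
    using Lebesgue_norm.abs_eq[OF diff(1)[OF that]] diff(2)[OF that] by simp
  obtain g where g: "g \<in> borel_measurable unit_interval_measure"
    "\<And>n. integrable unit_interval_measure (\<lambda>t. norm (g t - h n t) powr r)"
    "(\<lambda>n. LINT t|unit_interval_measure. norm (g t - h n t) powr r) \<longlonglongrightarrow> 0"
  proof (rule riesz_fischer[of unit_interval_measure r h])
    show "finite_measure unit_interval_measure"
      by (rule finite_measure_lebesgue_on) auto
    show "integrable unit_interval_measure (\<lambda>t. norm (h m t - h n t) powr r)" for m n
      using in_L[of "h m" n] h in_Lebesgue_diff[OF r f f] by simp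
    fix e :: real assume e: "0 < e"
    then obtain N where N: "\<forall>m\<ge>N. \<forall>n\<ge>N. Lebesgue_norm r (f m - f n) < e powr (1 / r)"
      using Cauchy[of "e powr (1 / r)"] by auto
    have "(LINT t|unit_interval_measure. norm (h m t - h n t) powr r) < e" if "N \<le> m" "N \<le> n" for m n
    proof (rule ccontr)
      assume "\<not> ?thesis"
      then have "e powr (1 / r) \<le> (LINT t|unit_interval_measure. norm (h m t - h n t) powr r) powr (1 / r)"
        using e r by (intro powr_mono2) auto
      then show False
        using N that norm_L[of "h m" n] h by fastforce
    qed
    then show "\<exists>N. \<forall>m\<ge>N. \<forall>n\<ge>N. (LINT t|unit_interval_measure. norm (h m t - h n t) powr r) < e"
      by blast
  qed (use r in auto)
  have gg: "ae_eq g g"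
    using g by (simp add: ae_eq_def)
  have "in_Lebesgue r ((abs_ae_fun g - f 0) + f 0)"
    using in_L[OF gg] g f by (intro in_Lebesgue_add r) auto
  moreover have "(\<lambda>n. Lebesgue_norm r (abs_ae_fun g - f n)) \<longlonglongrightarrow> 0"
  proof -
    have "(\<lambda>n. (LINT t|unit_interval_measure. norm (g t - h n t) powr r) powr (1 / r)) \<longlonglongrightarrow> 0 powr (1 / r)"
      using r by (intro tendsto_powr2 g tendsto_const) (auto intro: always_eventually)
    then show ?thesis
      by (simp add: norm_L[OF gg])
  qed
  ultimately show ?thesis
    by (intro that[of "abs_ae_fun g"]) simp_all
qed

section \<open>Rademacher series\<close>

lemma ae_eq_rademacher_sum:
  fixes x :: "nat \<Rightarrow> 'k::{real_normed_field, second_countable_topology}"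
  shows "ae_eq (\<lambda>t. \<Sum>j\<in>A. rademacher j t *\<^sub>R x j) (\<lambda>t. \<Sum>j\<in>A. rademacher j t *\<^sub>R x j)"
proof -
  have "rademacher j \<in> borel_measurable unit_interval_measure" for j
    by (intro measurable_restrict_space1 measurable_completion)
       (simp add: borel_measurable_rademacher)
  then show ?thesis
    unfolding ae_eq_def by simp
qed

lift_definition rademacher_sum ::
  "nat \<Rightarrow> (nat \<Rightarrow> 'k) \<Rightarrow> 'k::{real_normed_field, second_countable_topology} ae_fun"
  is "\<lambda>n x t. \<Sum>j<n. rademacher j t *\<^sub>R x j"
  by (rule ae_eq_rademacher_sum)

lemma rademacher_sum_add: "rademacher_sum n (\<lambda>j. x j + y j) = rademacher_sum n x + rademacher_sum n y"
proof transfer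
  fix n and x y :: "nat \<Rightarrow> 'a"
  have "(\<lambda>t. (\<Sum>j<n. rademacher j t *\<^sub>R x j) + (\<Sum>j<n. rademacher j t *\<^sub>R y j))
      = (\<lambda>t. \<Sum>j<n. rademacher j t *\<^sub>R (x j + y j))"
    by (simp only: scaleR_add_right sum.distrib)
  then show "ae_eq (\<lambda>t. \<Sum>j<n. rademacher j t *\<^sub>R (x j + y j))
      (\<lambda>t. (\<Sum>j<n. rademacher j t *\<^sub>R x j) + (\<Sum>j<n. rademacher j t *\<^sub>R y j))"
    using ae_eq_rademacher_sum by simp
qed

lemma rademacher_sum_scale: "rademacher_sum n (\<lambda>j. c * x j) = scale_ae_fun c (rademacher_sum n x)"
proof transfer
  fix n and c :: 'a and x :: "nat \<Rightarrow> 'a"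
  have "(\<lambda>t. c * (\<Sum>j<n. rademacher j t *\<^sub>R x j)) = (\<lambda>t. \<Sum>j<n. rademacher j t *\<^sub>R (c * x j))"
    by (simp only: mult_scaleR_right sum_distrib_left)
  then show "ae_eq (\<lambda>t. \<Sum>j<n. rademacher j t *\<^sub>R (c * x j)) (\<lambda>t. c * (\<Sum>j<n. rademacher j t *\<^sub>R x j))"
    using ae_eq_rademacher_sum by simp
qed

lemma rademacher_sum_diff: "rademacher_sum n (\<lambda>j. x j - y j) = rademacher_sum n x - rademacher_sum n y"
  using rademacher_sum_add[of n "\<lambda>j. x j - y j" y] by (simp add: algebra_simps)

text \<open>
  Padding with zero coefficients turns the difference of two partial sums into a single one, to which
  Khintchine's inequality applies.
\<close>

lemma rademacher_sum_extend:
  assumes "n \<le> m"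
  shows "rademacher_sum n x = rademacher_sum m (\<lambda>j. if j < n then x j else 0)"
  using assms
proof transfer
  fix n m :: nat and x :: "nat \<Rightarrow> 'a"
  assume "n \<le> m"
  then have "(\<Sum>j<n. rademacher j t *\<^sub>R x j) = (\<Sum>j<m. rademacher j t *\<^sub>R (if j < n then x j else 0))" for t
    by (intro sum.mono_neutral_cong_left) auto
  then show "ae_eq (\<lambda>t. \<Sum>j<n. rademacher j t *\<^sub>R x j) (\<lambda>t. \<Sum>j<m. rademacher j t *\<^sub>R (if j < n then x j else 0))"
    using ae_eq_rademacher_sum by (simp only:)
qed

lemma rademacher_sum_norm:
  assumes "0 < r"
  shows "in_Lebesgue r (rademacher_sum n x)"
    and "Lebesgue_norm r (rademacher_sum n x) powr r = rad_mean (\<lambda>u. norm u powr r) n x 0"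
proof -
  let ?f = "\<lambda>t. norm (\<Sum>j<n. rademacher j t *\<^sub>R x j) powr r"
  have hi: "(?f has_integral rad_mean (\<lambda>u. norm u powr r) n x 0) {0..1}"
    using has_integral_rademacher_sum[of "\<lambda>u. norm u powr r" 0] by simp
  then have "?f absolutely_integrable_on {0..1}"
    by (intro nonnegative_absolutely_integrable_1) (auto simp: has_integral_iff)
  then have int: "integrable unit_interval_measure ?f"
    by (simp add: integrable_restrict_space set_integrable_def)
  then have "integral\<^sup>L unit_interval_measure ?f = integral {0..1} ?f"
    by (rule lebesgue_integral_eq_integral) simp
  with hi have eq: "integral\<^sup>L unit_interval_measure ?f = rad_mean (\<lambda>u. norm u powr r) n x 0"
    by (simp add: has_integral_iff)
  show "in_Lebesgue r (rademacher_sum n x)"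
    using int by transfer
  have "0 \<le> rad_mean (\<lambda>u. norm u powr r) n x 0"
    by (intro rad_mean_nonneg) simp
  moreover have "Lebesgue_norm r (rademacher_sum n x) = rad_mean (\<lambda>u. norm u powr r) n x 0 powr (1 / r)"
    using eq by transfer simp
  ultimately show "Lebesgue_norm r (rademacher_sum n x) powr r = rad_mean (\<lambda>u. norm u powr r) n x 0"
    using assms by (simp add: powr_powr)
qed

text \<open>
  The partial sums are classes of functions and converge in the norm of \<open>L\<^sub>r\<close>. Characterising the
  sum as their limit makes its linearity a consequence of uniqueness of limits.
\<close>

definition rademacher_limit :: "real \<Rightarrow> (nat \<Rightarrow> 'k) \<Rightarrow> 'k::{real_normed_field, second_countable_topology} ae_fun \<Rightarrow> bool"
  where "rademacher_limit r x F \<longleftrightarrow>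
    in_Lebesgue r F \<and> (\<lambda>n. Lebesgue_norm r (F - rademacher_sum n x)) \<longlonglongrightarrow> 0"

definition rademacher_series :: "real \<Rightarrow> (nat \<Rightarrow> 'k) \<Rightarrow> 'k::{real_normed_field, second_countable_topology} ae_fun"
  where "rademacher_series r x = (THE F. rademacher_limit r x F)"

lemma rademacher_limit_unique:
  assumes r: "1 \<le> r" and F: "rademacher_limit r x F" and G: "rademacher_limit r x G"
  shows "F = G"
proof -
  let ?S = "\<lambda>n. rademacher_sum n x"
  have L: "in_Lebesgue r F" "in_Lebesgue r G" "in_Lebesgue r (?S n)" for n
    using assms rademacher_sum_norm(1)[of r n x] by (auto simp: rademacher_limit_def)
  have "Lebesgue_norm r (F - G) \<le> Lebesgue_norm r (F - ?S n) + Lebesgue_norm r (G - ?S n)" for n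
    using Lebesgue_norm_triangle[OF r in_Lebesgue_diff[OF r L(1,3)] in_Lebesgue_diff[OF r L(3,2)], of n n]
      Lebesgue_norm_minus_commute[of r "?S n" G] by simp
  moreover have "(\<lambda>n. Lebesgue_norm r (F - ?S n) + Lebesgue_norm r (G - ?S n)) \<longlonglongrightarrow> 0 + 0"
    using F G unfolding rademacher_limit_def by (intro tendsto_add) auto
  ultimately have "Lebesgue_norm r (F - G) \<le> 0 + 0"
    by (intro LIMSEQ_le_const) auto
  then have "Lebesgue_norm r (F - G) = 0"
    using Lebesgue_norm_nonneg[of r "F - G"] by simp
  then show ?thesis
    using Lebesgue_norm_eq_0_iff[of r "F - G"] in_Lebesgue_diff[OF r L(1,2)] r by simp
qed

lemma rademacher_series_eqI:
  "1 \<le> r \<Longrightarrow> rademacher_limit r x F \<Longrightarrow> rademacher_series r x = F"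
  unfolding rademacher_series_def by (blast intro: the_equality rademacher_limit_unique)

lemma rademacher_limit_add:
  assumes r: "1 \<le> r" and F: "rademacher_limit r x F" and G: "rademacher_limit r y G"
  shows "rademacher_limit r (\<lambda>j. x j + y j) (F + G)"
proof -
  let ?d = "\<lambda>n. Lebesgue_norm r (F + G - rademacher_sum n (\<lambda>j. x j + y j))"
  have L: "in_Lebesgue r F" "in_Lebesgue r G" "in_Lebesgue r (rademacher_sum n x)" "in_Lebesgue r (rademacher_sum n y)" for n
    using assms rademacher_sum_norm(1)[of r n] by (auto simp: rademacher_limit_def)
  have bound: "?d n \<le> Lebesgue_norm r (F - rademacher_sum n x) + Lebesgue_norm r (G - rademacher_sum n y)" for n
    using Lebesgue_norm_triangle[OF r in_Lebesgue_diff[OF r L(1,3)] in_Lebesgue_diff[OF r L(2,4)], of n n]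
    by (simp add: rademacher_sum_add algebra_simps)
  have "?d \<longlonglongrightarrow> 0"
  proof (rule Lim_null_comparison)
    show "eventually (\<lambda>n. norm (?d n) \<le> Lebesgue_norm r (F - rademacher_sum n x) + Lebesgue_norm r (G - rademacher_sum n y)) sequentially"
      using bound by (simp add: Lebesgue_norm_nonneg)
    show "(\<lambda>n. Lebesgue_norm r (F - rademacher_sum n x) + Lebesgue_norm r (G - rademacher_sum n y)) \<longlonglongrightarrow> 0"
      using F G unfolding rademacher_limit_def by (intro tendsto_add_zero) auto
  qed
  then show ?thesis
    using L in_Lebesgue_add[OF r] by (simp add: rademacher_limit_def)
qed

lemma scale_ae_fun_diff: "scale_ae_fun c (f - g) = scale_ae_fun c f - scale_ae_fun c g"
  by transfer (auto simp: ae_eq_def algebra_simps)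

lemma scale_ae_fun_diff_left: "scale_ae_fun (c - d) f = scale_ae_fun c f - scale_ae_fun d f"
  by transfer (auto simp: ae_eq_def algebra_simps)

lemma rademacher_limit_scale:
  assumes r: "1 \<le> r" and F: "rademacher_limit r x F"
  shows "rademacher_limit r (\<lambda>j. c * x j) (scale_ae_fun c F)"
proof -
  have "(\<lambda>n. norm c * Lebesgue_norm r (F - rademacher_sum n x)) \<longlonglongrightarrow> 0"
    using F unfolding rademacher_limit_def by (intro tendsto_mult_right_zero) auto
  then show ?thesis
    using F r unfolding rademacher_limit_def
    by (simp add: rademacher_sum_scale in_Lebesgue_scale Lebesgue_norm_scale flip: scale_ae_fun_diff)
qed

lemma rademacher_limit_exists:
  fixes x :: "nat \<Rightarrow> 'k::{real_normed_field, euclidean_space}"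
  assumes r: "2 < r" and x: "summable (\<lambda>n. (norm (x n))\<^sup>2)"
  shows "\<exists>F. rademacher_limit r x F"
proof -
  obtain C where C: "0 < C"
    "\<And>(x :: nat \<Rightarrow> 'k) n. rad_mean (\<lambda>u. norm u powr r) n x 0 \<le> (C * sqrt (\<Sum>j<n. (norm (x j))\<^sup>2)) powr r"
    using khintchine_constant[OF r] by metis
  have tail: "Lebesgue_norm r (rademacher_sum m x - rademacher_sum n x) \<le> C * sqrt (\<Sum>j\<in>{n..<m}. (norm (x j))\<^sup>2)"
    if "n \<le> m" for m n
  proof -
    let ?z = "\<lambda>j. x j - (if j < n then x j else 0)"
    have "(\<Sum>j<m. (norm (?z j))\<^sup>2) = (\<Sum>j\<in>{n..<m}. (norm (x j))\<^sup>2)"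
      by (intro sum.mono_neutral_cong_right) auto
    then have "Lebesgue_norm r (rademacher_sum m ?z) powr r \<le> (C * sqrt (\<Sum>j\<in>{n..<m}. (norm (x j))\<^sup>2)) powr r"
      using C(2)[of m ?z] rademacher_sum_norm(2)[of r m ?z] r by simp
    then have "Lebesgue_norm r (rademacher_sum m ?z) \<le> C * sqrt (\<Sum>j\<in>{n..<m}. (norm (x j))\<^sup>2)"
      by (rule powr_le_powr_imp_le) (use r C in \<open>auto simp: Lebesgue_norm_nonneg sum_nonneg\<close>)
    then show ?thesis
      by (simp only: rademacher_sum_extend[OF that, of x] rademacher_sum_diff)
  qed
  have "\<exists>N. \<forall>m\<ge>N. \<forall>n\<ge>N. Lebesgue_norm r (rademacher_sum m x - rademacher_sum n x) < e" if e: "0 < e" for e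
  proof -
    obtain N where N: "\<And>n m. n \<ge> N \<Longrightarrow> norm (\<Sum>j\<in>{n..<m}. (norm (x j))\<^sup>2) < (e / C)\<^sup>2"
      using x e C(1) unfolding summable_Cauchy by (meson divide_pos_pos zero_less_power)
    have "Lebesgue_norm r (rademacher_sum m x - rademacher_sum n x) < e" if "N \<le> n" "n \<le> m" for m n
    proof -
      have "(\<Sum>j\<in>{n..<m}. (norm (x j))\<^sup>2) < (e / C)\<^sup>2"
        using N[OF that(1), of m] by (simp only: real_norm_def abs_less_iff)
      then have "sqrt (\<Sum>j\<in>{n..<m}. (norm (x j))\<^sup>2) < e / C"
        using e C(1) by (intro real_less_lsqrt) auto
      then have "C * sqrt (\<Sum>j\<in>{n..<m}. (norm (x j))\<^sup>2) < e"
        using C(1) by (simp add: pos_less_divide_eq mult.commute)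
      then show ?thesis
        using tail[OF that(2)] by simp
    qed
    then show ?thesis
      by (metis Lebesgue_norm_minus_commute nle_le)
  qed
  note Cauchy = this
  show ?thesis
  proof (rule Lebesgue_complete[of r "\<lambda>n. rademacher_sum n x"])
    show "in_Lebesgue r (rademacher_sum n x)" for n
      using r by (intro rademacher_sum_norm) simp
    show "\<exists>N. \<forall>m\<ge>N. \<forall>n\<ge>N. Lebesgue_norm r (rademacher_sum m x - rademacher_sum n x) < e" if "0 < e" for e
      using that by (rule Cauchy)
    show ?thesis if "in_Lebesgue r F" "(\<lambda>n. Lebesgue_norm r (F - rademacher_sum n x)) \<longlonglongrightarrow> 0" for F
      using that by (auto simp: rademacher_limit_def)
  qed (use r in simp)
qed

text \<open>
  The link between analysis and combinatorics: every later statement about norms in \<open>L\<^sub>r\<close> is read off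
  from averages over signs by means of this limit.
\<close>

lemma rademacher_limit_norm:
  assumes r: "1 \<le> r" and F: "rademacher_limit r x F"
  shows "(\<lambda>n. rad_mean (\<lambda>u. norm u powr r) n x 0) \<longlonglongrightarrow> Lebesgue_norm r F powr r"
proof -
  let ?S = "\<lambda>n. rademacher_sum n x"
  have L: "in_Lebesgue r F" "in_Lebesgue r (?S n)" for n
    using assms rademacher_sum_norm(1)[of r n x] by (auto simp: rademacher_limit_def)
  have bound: "\<bar>Lebesgue_norm r (?S n) - Lebesgue_norm r F\<bar> \<le> Lebesgue_norm r (F - ?S n)" for n
    using Lebesgue_norm_triangle[OF r in_Lebesgue_diff[OF r L(1,2)] L(2), of n n]
      Lebesgue_norm_triangle[OF r in_Lebesgue_diff[OF r L(2,1)] L(1), of n]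
      Lebesgue_norm_minus_commute[of r F "?S n"] by simp
  have "(\<lambda>n. Lebesgue_norm r (?S n) - Lebesgue_norm r F) \<longlonglongrightarrow> 0"
  proof (rule Lim_null_comparison)
    show "eventually (\<lambda>n. norm (Lebesgue_norm r (?S n) - Lebesgue_norm r F) \<le> Lebesgue_norm r (F - ?S n)) sequentially"
      using bound by simp
    show "(\<lambda>n. Lebesgue_norm r (F - ?S n)) \<longlonglongrightarrow> 0"
      using F by (simp add: rademacher_limit_def)
  qed
  then have "(\<lambda>n. Lebesgue_norm r (?S n)) \<longlonglongrightarrow> Lebesgue_norm r F"
    by (rule LIM_zero_cancel)
  then have "(\<lambda>n. Lebesgue_norm r (?S n) powr r) \<longlonglongrightarrow> Lebesgue_norm r F powr r"
    using r by (intro tendsto_powr2) (auto simp: Lebesgue_norm_nonneg intro: always_eventually)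
  then show ?thesis
    using r by (simp add: rademacher_sum_norm(2))
qed

section \<open>Operators from the sequence space to the Lebesgue space\<close>

lemma ell2_simps [simp]:
  "x \<in> pts ell2 \<longleftrightarrow> summable (\<lambda>n. (norm (x n))\<^sup>2)"
  "scal ell2 c x = (\<lambda>n. c * x n)"
  "nrm ell2 x = sqrt (\<Sum>n. (norm (x n))\<^sup>2)"
  by (simp_all add: ell2_def)

lemma Lebesgue_space_simps [simp]:
  "f \<in> pts (Lebesgue_space r) \<longleftrightarrow> in_Lebesgue r f"
  "scal (Lebesgue_space r) = scale_ae_fun"
  "nrm (Lebesgue_space r) = Lebesgue_norm r"
  by (simp_all add: Lebesgue_space_def)

lemma norm_topology_Lebesgue:
  "norm_topology (Lebesgue_space r) =
    Metric_space.mtopology {f. in_Lebesgue r f} (\<lambda>f g. Lebesgue_norm r (f - g))"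
  by (simp add: norm_topology_def Lebesgue_space_def)

lemma compactin_line_segment:
  fixes e :: "'k::{real_normed_field, euclidean_space} ae_fun"
  assumes r: "1 \<le> r" and e: "in_Lebesgue r e"
  shows "compactin (norm_topology (Lebesgue_space r)) ((\<lambda>c. scale_ae_fun c e) ` cball 0 B)"
proof -
  interpret Metric_space "{f :: 'k ae_fun. in_Lebesgue r f}" "\<lambda>f g. Lebesgue_norm r (f - g)"
    by (rule Metric_space_Lebesgue[OF r])
  have "continuous_map euclidean mtopology (\<lambda>c. scale_ae_fun c e)"
    unfolding continuous_map_to_metric
  proof (intro ballI allI impI)
    fix c :: 'k and \<epsilon> :: real
    assume \<epsilon>: "0 < \<epsilon>"
    define L where "L = Lebesgue_norm r e + 1"
    have L: "0 < L" "Lebesgue_norm r e < L"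
      using Lebesgue_norm_nonneg[of r e] by (simp_all add: L_def)
    have "scale_ae_fun d e \<in> mball (scale_ae_fun c e) \<epsilon>" if "d \<in> ball c (\<epsilon> / L)" for d
    proof -
      have "norm (c - d) * Lebesgue_norm r e \<le> norm (c - d) * L"
        using L by (intro mult_left_mono) auto
      also have "\<dots> < \<epsilon>"
        using that L by (simp add: dist_norm pos_less_divide_eq)
      finally show ?thesis
        using e r by (simp add: in_mball in_Lebesgue_scale Lebesgue_norm_scale flip: scale_ae_fun_diff_left)
    qed
    then show "\<exists>U. openin euclidean U \<and> c \<in> U \<and> (\<forall>d\<in>U. scale_ae_fun d e \<in> mball (scale_ae_fun c e) \<epsilon>)"
      using \<epsilon> L by (intro exI[of _ "ball c (\<epsilon> / L)"]) auto
  qed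
  then have "compactin mtopology ((\<lambda>c. scale_ae_fun c e) ` cball 0 B)"
    by (rule image_compactin[rotated]) simp
  then show ?thesis
    by (simp add: norm_topology_Lebesgue)
qed

text \<open>
  The image of the unit ball lies in the continuous image of the compact disc of scalars, which is
  closed because the topology is Hausdorff.
\<close>

lemma compact_op_first_coordinate:
  fixes e :: "'k::{real_normed_field, euclidean_space} ae_fun"
  assumes r: "1 \<le> r" and lin: "linear_op ell2 (Lebesgue_space r) K" and e: "in_Lebesgue r e"
    and K: "\<And>x. x \<in> pts ell2 \<Longrightarrow> K x = scale_ae_fun (x 0) e"
  shows "compact_op ell2 (Lebesgue_space r) K"
proof -
  interpret Metric_space "{f :: 'k ae_fun. in_Lebesgue r f}" "\<lambda>f g. Lebesgue_norm r (f - g)"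
    by (rule Metric_space_Lebesgue[OF r])
  let ?Y = "norm_topology (Lebesgue_space r :: ('k, 'k ae_fun) normed_space)"
  let ?L = "(\<lambda>c. scale_ae_fun c e) ` cball 0 1"
  have "K x \<in> ?L" if "x \<in> unit_ball ell2" for x
  proof -
    have x: "summable (\<lambda>n. (norm (x n))\<^sup>2)" "(\<Sum>n. (norm (x n))\<^sup>2) \<le> 1"
      using that by (auto simp: unit_ball_def)
    have "(norm (x 0))\<^sup>2 \<le> (\<Sum>n. (norm (x n))\<^sup>2)"
      using sum_le_suminf[OF x(1), of "{0}"] by simp
    then have "(norm (x 0))\<^sup>2 \<le> 1"
      using x(2) by (rule order_trans)
    then have "norm (x 0) \<le> 1"
      by (simp add: power_le_one_iff)
    then show ?thesis
      using K[of x] x(1) by auto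
  qed
  then have sub: "K ` unit_ball ell2 \<subseteq> ?L"
    by blast
  have comp: "compactin ?Y ?L"
    by (rule compactin_line_segment[OF r e])
  have "Hausdorff_space ?Y"
    unfolding norm_topology_Lebesgue by (rule Hausdorff_space_mtopology)
  then have closed: "closedin ?Y ?L"
    using comp by (rule compactin_imp_closedin)
  have "compactin ?Y (?Y closure_of (K ` unit_ball ell2))"
    by (rule closed_compactin[OF comp closure_of_minimal[OF sub closed] closedin_closure_of])
  then show ?thesis
    using lin by (simp add: compact_op_def)
qed

definition weighted_series ::
  "real \<Rightarrow> (nat \<Rightarrow> real) \<Rightarrow> (nat \<Rightarrow> 'k) \<Rightarrow> 'k::{real_normed_field, euclidean_space} ae_fun"
  where "weighted_series r w x = rademacher_series r (\<lambda>n. w n *\<^sub>R x n)"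

lemma weighted_summable:
  fixes x :: "nat \<Rightarrow> 'a::real_normed_vector"
  assumes "summable (\<lambda>n. (norm (x n))\<^sup>2)" "\<And>n. \<bar>w n\<bar> \<le> W"
  shows "summable (\<lambda>n. (norm (w n *\<^sub>R x n))\<^sup>2)"
proof (rule summable_comparison_test)
  have "(norm (w n *\<^sub>R x n))\<^sup>2 \<le> W\<^sup>2 * (norm (x n))\<^sup>2" for n
    unfolding norm_scaleR power_mult_distrib using assms(2)[of n]
    by (intro mult_right_mono power_mono) auto
  then show "\<exists>N. \<forall>n\<ge>N. norm ((norm (w n *\<^sub>R x n))\<^sup>2) \<le> W\<^sup>2 * (norm (x n))\<^sup>2"
    by simp
  show "summable (\<lambda>n. W\<^sup>2 * (norm (x n))\<^sup>2)"
    by (intro summable_mult assms)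
qed

lemma weighted_series_limit:
  fixes x :: "nat \<Rightarrow> 'k::{real_normed_field, euclidean_space}"
  assumes "2 < r" "\<And>n. \<bar>w n\<bar> \<le> W" "summable (\<lambda>n. (norm (x n))\<^sup>2)"
  shows "rademacher_limit r (\<lambda>n. w n *\<^sub>R x n) (weighted_series r w x)"
proof -
  obtain F where F: "rademacher_limit r (\<lambda>n. w n *\<^sub>R x n) F"
    using rademacher_limit_exists[OF assms(1) weighted_summable[of x w W]] assms by blast
  then have "weighted_series r w x = F"
    unfolding weighted_series_def using assms(1) by (intro rademacher_series_eqI) auto
  with F show ?thesis
    by simp
qed

lemma weighted_series_add_weights:
  assumes "2 < r" "\<And>n. \<bar>v n\<bar> \<le> V" "\<And>n. \<bar>w n\<bar> \<le> W" "summable (\<lambda>n. (norm (x n))\<^sup>2)"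
  shows "weighted_series r (\<lambda>n. v n + w n) x = weighted_series r v x + weighted_series r w x"
proof -
  have "rademacher_limit r (\<lambda>n. v n *\<^sub>R x n + w n *\<^sub>R x n) (weighted_series r v x + weighted_series r w x)"
    using assms by (intro rademacher_limit_add weighted_series_limit) auto
  then show ?thesis
    unfolding weighted_series_def[of _ "\<lambda>n. v n + w n"] using assms(1)
    by (intro rademacher_series_eqI) (simp_all add: scaleR_add_left)
qed

lemma linear_op_weighted_series:
  assumes r: "2 < r" and w: "\<And>n. \<bar>w n\<bar> \<le> W"
  shows "linear_op ell2 (Lebesgue_space r) (weighted_series r w)"
  unfolding linear_op_def
proof (intro conjI ballI allI)
  fix x :: "nat \<Rightarrow> 'a" assume "x \<in> pts ell2"
  then have x: "rademacher_limit r (\<lambda>n. w n *\<^sub>R x n) (weighted_series r w x)"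
    using weighted_series_limit[OF r w] by simp
  then show "weighted_series r w x \<in> pts (Lebesgue_space r)"
    by (simp add: rademacher_limit_def)
  show "weighted_series r w (scal ell2 c x) = scal (Lebesgue_space r) c (weighted_series r w x)" for c
    using rademacher_limit_scale[OF _ x, of c] r
    unfolding weighted_series_def[of _ _ "scal ell2 c x"]
    by (intro rademacher_series_eqI) simp_all
  fix y :: "nat \<Rightarrow> 'a" assume "y \<in> pts ell2"
  then have "rademacher_limit r (\<lambda>n. w n *\<^sub>R y n) (weighted_series r w y)"
    using weighted_series_limit[OF r w] by simp
  from rademacher_limit_add[OF _ x this] r
  show "weighted_series r w (x + y) = weighted_series r w x + weighted_series r w y"
    unfolding weighted_series_def[of _ _ "x + y"]
    by (intro rademacher_series_eqI) (simp_all add: scaleR_add_right)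
qed

lemma weighted_series_norm_limit:
  assumes "2 < r" "\<And>n. \<bar>w n\<bar> \<le> W" "summable (\<lambda>n. (norm (x n))\<^sup>2)"
  shows "(\<lambda>n. rad_mean (\<lambda>u. norm u powr r) n (\<lambda>n. w n *\<^sub>R x n) 0)
    \<longlonglongrightarrow> Lebesgue_norm r (weighted_series r w x) powr r"
  using rademacher_limit_norm[OF _ weighted_series_limit[OF assms]] assms(1) by simp

lemma weighted_series_norm_le:
  fixes x :: "nat \<Rightarrow> 'k::{real_normed_field, euclidean_space}"
  assumes r: "2 < r" and w: "\<And>n. \<bar>w n\<bar> \<le> W" and x: "summable (\<lambda>n. (norm (x n))\<^sup>2)"
    and C: "0 \<le> C" "\<And>(x :: nat \<Rightarrow> 'k) n. rad_mean (\<lambda>u. norm u powr r) n x 0 \<le> (C * sqrt (\<Sum>j<n. (norm (x j))\<^sup>2)) powr r"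
  shows "Lebesgue_norm r (weighted_series r w x) \<le> C * W * sqrt (\<Sum>n. (norm (x n))\<^sup>2)"
proof -
  have W: "0 \<le> W" using w[of 0] by simp
  let ?B = "C * W * sqrt (\<Sum>n. (norm (x n))\<^sup>2)"
  have "rad_mean (\<lambda>u. norm u powr r) n (\<lambda>n. w n *\<^sub>R x n) 0 \<le> ?B powr r" for n
  proof -
    have "(\<Sum>j<n. (norm (w j *\<^sub>R x j))\<^sup>2) \<le> (\<Sum>j<n. W\<^sup>2 * (norm (x j))\<^sup>2)"
      unfolding norm_scaleR power_mult_distrib using w
      by (intro sum_mono mult_right_mono power_mono) auto
    also have "\<dots> \<le> W\<^sup>2 * (\<Sum>n. (norm (x n))\<^sup>2)"
      unfolding sum_distrib_left[symmetric] using x by (intro mult_left_mono sum_le_suminf) auto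
    finally have "sqrt (\<Sum>j<n. (norm (w j *\<^sub>R x j))\<^sup>2) \<le> W * sqrt (\<Sum>n. (norm (x n))\<^sup>2)"
      using W by (metis real_sqrt_le_mono real_sqrt_mult real_sqrt_abs abs_of_nonneg)
    then have "(C * sqrt (\<Sum>j<n. (norm (w j *\<^sub>R x j))\<^sup>2)) powr r \<le> ?B powr r"
      using C(1) r by (intro powr_mono2) (auto simp: sum_nonneg mult.assoc intro!: mult_left_mono)
    then show ?thesis
      using C(2)[of n "\<lambda>n. w n *\<^sub>R x n"] by simp
  qed
  then have "Lebesgue_norm r (weighted_series r w x) powr r \<le> ?B powr r"
    by (intro LIMSEQ_le_const2[OF weighted_series_norm_limit[OF r w x]]) auto
  then show ?thesis
    by (rule powr_le_powr_imp_le) (use r C W in \<open>auto simp: Lebesgue_norm_nonneg suminf_nonneg[OF x]\<close>)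
qed

lemma op_norm_weighted_series:
  assumes r: "2 < r" and w: "\<And>n. \<bar>w n\<bar> \<le> W"
    and C: "0 \<le> C" "\<And>(x :: nat \<Rightarrow> 'k::{real_normed_field, euclidean_space}) n.
      rad_mean (\<lambda>u. norm u powr r) n x 0 \<le> (C * sqrt (\<Sum>j<n. (norm (x j))\<^sup>2)) powr r"
  defines "T \<equiv> weighted_series r w :: (nat \<Rightarrow> 'k) \<Rightarrow> _"
  shows "op_norm ell2 (Lebesgue_space r) T \<le> C * W"
    and "x \<in> unit_ball ell2 \<Longrightarrow> Lebesgue_norm r (T x) \<le> op_norm ell2 (Lebesgue_space r) T"
proof -
  have W: "0 \<le> W" using w[of 0] by simp
  have le: "Lebesgue_norm r (T y) \<le> C * W" if "y \<in> unit_ball ell2" for y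
  proof -
    have "Lebesgue_norm r (T y) \<le> C * W * sqrt (\<Sum>n. (norm (y n))\<^sup>2)"
      unfolding T_def using that by (intro weighted_series_norm_le r w C) (auto simp: unit_ball_def)
    also have "\<dots> \<le> C * W * 1"
      using that C W by (intro mult_left_mono) (auto simp: unit_ball_def)
    finally show ?thesis by simp
  qed
  have "(\<lambda>_. 0) \<in> unit_ball (ell2 :: ('k, nat \<Rightarrow> 'k) normed_space)"
    by (simp add: unit_ball_def)
  then show "op_norm ell2 (Lebesgue_space r) T \<le> C * W"
    unfolding op_norm_def by (intro cSUP_least) (auto intro: le)
  show "x \<in> unit_ball ell2 \<Longrightarrow> Lebesgue_norm r (T x) \<le> op_norm ell2 (Lebesgue_space r) T"
    unfolding op_norm_def using le by (auto intro!: cSUP_upper2 bdd_aboveI2)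
qed

section \<open>Failure of norm attainment\<close>

text \<open>
  The isometry of the sequence space that moves the coordinates from index 1 on one place to the
  right and leaves the coordinate 0 fixed.
\<close>

definition spread_tail :: "(nat \<Rightarrow> 'a::zero) \<Rightarrow> nat \<Rightarrow> 'a" where
  "spread_tail x n = (case n of 0 \<Rightarrow> x 0 | Suc 0 \<Rightarrow> 0 | Suc (Suc m) \<Rightarrow> x (Suc m))"

lemma spread_tail_simps [simp]:
  "spread_tail x 0 = x 0" "spread_tail x (Suc 0) = 0" "spread_tail x (Suc (Suc m)) = x (Suc m)"
  by (simp_all add: spread_tail_def)

lemma spread_tail_sums:
  fixes f :: "nat \<Rightarrow> real"
  assumes "summable f"
  shows "summable (spread_tail f)" "suminf (spread_tail f) = suminf f"
proof -
  have "summable (\<lambda>n. f (Suc n))"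
    using assms by (simp add: summable_Suc_iff)
  then have 1: "summable (\<lambda>n. spread_tail f (Suc (Suc n)))"
    by simp
  then have 2: "summable (\<lambda>n. spread_tail f (Suc n))"
    by (subst (asm) summable_Suc_iff)
  then show 3: "summable (spread_tail f)"
    by (subst (asm) summable_Suc_iff)
  show "suminf (spread_tail f) = suminf f"
    using suminf_split_head[OF 3] suminf_split_head[OF 2] suminf_split_head[OF assms] by simp
qed

lemma spread_tail_norm:
  fixes x :: "nat \<Rightarrow> 'a::real_normed_vector"
  assumes "summable (\<lambda>n. (norm (x n))\<^sup>2)"
  shows "summable (\<lambda>n. (norm (spread_tail x n))\<^sup>2)"
    and "(\<Sum>n. (norm (spread_tail x n))\<^sup>2) = (\<Sum>n. (norm (x n))\<^sup>2)"
proof -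
  have "(\<lambda>n. (norm (spread_tail x n))\<^sup>2) = spread_tail (\<lambda>n. (norm (x n))\<^sup>2)"
    by (rule ext) (simp add: spread_tail_def split: nat.split)
  then show "summable (\<lambda>n. (norm (spread_tail x n))\<^sup>2)"
    "(\<Sum>n. (norm (spread_tail x n))\<^sup>2) = (\<Sum>n. (norm (x n))\<^sup>2)"
    using spread_tail_sums[OF assms] by simp_all
qed

text \<open>
  A zero coefficient does not affect an average over signs, so the image of the spread sequence has
  the norm of the series with coefficients \<open>w\<^sub>0 x\<^sub>0\<close> and \<open>w\<^sub>n\<^sub>+\<^sub>1 x\<^sub>n\<close> for \<open>n \<ge> 1\<close>. Compared with
  \<open>w\<^sub>n x\<^sub>n\<close> these are enlarged by the factors \<open>t n \<ge> 1\<close>, and strictly at the index of a nonzero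
  coordinate. The gain \<open>\<delta>\<close> in the averages does not depend on their length, so it is still there
  in the limit.
\<close>

lemma spread_tail_increases_norm:
  fixes x :: "nat \<Rightarrow> 'k::{real_normed_field, euclidean_space}"
  assumes r: "2 < r" and w: "\<And>n. \<bar>w n\<bar> \<le> W" and x: "summable (\<lambda>n. (norm (x n))\<^sup>2)"
    and pos: "\<And>n. 0 < w (Suc n)" and incr: "\<And>n. w (Suc n) < w (Suc (Suc n))"
    and i: "x (Suc i) \<noteq> 0"
  shows "Lebesgue_norm r (weighted_series r w x) < Lebesgue_norm r (weighted_series r w (spread_tail x))"
proof -
  let ?F = "\<lambda>u :: 'k. norm u powr r"
  define y where "y n = w n *\<^sub>R x n" for n
  define t where "t n = (if n = 0 then 1 else w (Suc n) / w n)" for n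
  define z where "z n = t n *\<^sub>R y n" for n
  define \<delta> where "\<delta> = (t (Suc i) - 1) * norm (y (Suc i)) powr r"
  have t: "1 \<le> t n" for n
    using pos[of "n - 1"] incr[of "n - 1"] by (cases n) (auto simp: t_def)
  have "1 < t (Suc i)"
    using pos[of i] incr[of i] by (simp add: t_def)
  then have \<delta>: "0 < \<delta>"
    using i pos[of i] by (simp add: \<delta>_def y_def)
  have gap: "rad_mean ?F n y 0 + \<delta> \<le> rad_mean ?F n z 0" if "Suc i < n" for n
    unfolding \<delta>_def z_def using r that t
    by (intro rad_mean_dilation_gap[where g = "\<lambda>c. norm c powr r"] convex_on_norm_powr norm_powr_midpoint_gap) auto
  have z: "w (Suc (Suc m)) *\<^sub>R x (Suc m) = z (Suc m)" "z 0 = y 0" for m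
    using pos[of m] by (simp_all add: z_def t_def y_def)
  have shift: "rad_mean ?F (Suc (Suc m)) (\<lambda>n. w n *\<^sub>R spread_tail x n) 0 = rad_mean ?F (Suc m) z 0" for m
    by (simp add: z y_def)
  have lim: "(\<lambda>n. rad_mean ?F n y 0) \<longlonglongrightarrow> Lebesgue_norm r (weighted_series r w x) powr r"
    unfolding y_def by (rule weighted_series_norm_limit[OF r w x])
  have lim': "(\<lambda>n. rad_mean ?F (Suc (Suc n)) (\<lambda>n. w n *\<^sub>R spread_tail x n) 0)
      \<longlonglongrightarrow> Lebesgue_norm r (weighted_series r w (spread_tail x)) powr r"
    using weighted_series_norm_limit[OF r w spread_tail_norm(1)[OF x]]
    by (intro LIMSEQ_Suc)
  have "Lebesgue_norm r (weighted_series r w x) powr r + \<delta>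
      \<le> Lebesgue_norm r (weighted_series r w (spread_tail x)) powr r"
  proof (rule LIMSEQ_le[OF tendsto_add[OF LIMSEQ_Suc[OF lim] tendsto_const] lim'])
    show "\<exists>N. \<forall>n\<ge>N. rad_mean ?F (Suc n) y 0 + \<delta> \<le> rad_mean ?F (Suc (Suc n)) (\<lambda>n. w n *\<^sub>R spread_tail x n) 0"
      unfolding shift by (intro exI[of _ "Suc i"] allI impI gap) simp
  qed
  with \<delta> have "Lebesgue_norm r (weighted_series r w x) powr r
      < Lebesgue_norm r (weighted_series r w (spread_tail x)) powr r"
    by simp
  then show ?thesis
    using r powr_mono2[of r "Lebesgue_norm r (weighted_series r w (spread_tail x))"]
    by (meson Lebesgue_norm_nonneg less_eq_real_def not_le order_less_trans zero_less_numeral)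
qed

lemma weighted_series_norm_finite_support:
  fixes x :: "nat \<Rightarrow> 'k::{real_normed_field, euclidean_space}"
  assumes r: "2 < r" and w: "\<And>n. \<bar>w n\<bar> \<le> W" and x: "summable (\<lambda>n. (norm (x n))\<^sup>2)"
    and supp: "\<And>n. 2 \<le> n \<Longrightarrow> x n = 0"
  shows "Lebesgue_norm r (weighted_series r w x) powr r =
    (norm (w 0 *\<^sub>R x 0 + w 1 *\<^sub>R x 1) powr r + norm (w 0 *\<^sub>R x 0 - w 1 *\<^sub>R x 1) powr r) / 2"
proof -
  let ?F = "\<lambda>u :: 'k. norm u powr r"
  let ?a = "w 0 *\<^sub>R x 0" and ?b = "w 1 *\<^sub>R x 1"
  have "rad_mean ?F (Suc (Suc n)) (\<lambda>n. w n *\<^sub>R x n) 0 = (norm (?a + ?b) powr r + norm (?a - ?b) powr r) / 2" for n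
  proof -
    have "norm (- ?a - ?b) = norm (?a + ?b)" "norm (- ?a + ?b) = norm (?a - ?b)"
      using norm_minus_cancel[of "?a + ?b"] norm_minus_cancel[of "?a - ?b"] by simp_all
    moreover have "rad_mean ?F n (\<lambda>j. w (Suc (Suc j)) *\<^sub>R x (Suc (Suc j))) u = ?F u" for u
      using supp by (intro rad_mean_zero) simp
    ultimately show ?thesis
      by (simp add: add_divide_distrib)
  qed
  moreover have "(\<lambda>n. rad_mean ?F (Suc (Suc n)) (\<lambda>n. w n *\<^sub>R x n) 0)
      \<longlonglongrightarrow> Lebesgue_norm r (weighted_series r w x) powr r"
    by (intro LIMSEQ_Suc weighted_series_norm_limit[OF r w x])
  ultimately show ?thesis
    by (simp only: LIMSEQ_const_iff)
qed

text \<open>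
  \<open>T\<close> has weight 0 at index 0 and weights increasing from \<open>q\<close> towards 1 after it, \<open>K\<close> has the single
  weight \<open>C\<close> at index 0, and \<open>S = T + K\<close>.
\<close>

lemma not_compact_perturbation_property:
  fixes r :: real
  assumes r: "2 < r"
  shows "\<not> compact_perturbation_property
    (ell2 :: ('k::{real_normed_field, euclidean_space}, nat \<Rightarrow> 'k) normed_space) (Lebesgue_space r)"
proof
  let ?X = "ell2 :: ('k, nat \<Rightarrow> 'k) normed_space" and ?Y = "Lebesgue_space r :: ('k, 'k ae_fun) normed_space"
  assume CPP: "compact_perturbation_property ?X ?Y"
  obtain C where C: "0 < C" "C\<^sup>2 < r - 1"
    and khin: "\<And>(x :: nat \<Rightarrow> 'k) n. rad_mean (\<lambda>u. norm u powr r) n x 0 \<le> (C * sqrt (\<Sum>j<n. (norm (x j))\<^sup>2)) powr r"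
    using khintchine_constant[OF r] by metis
  have C0: "0 \<le> C" using C by simp
  have "C < sqrt (r - 1)"
    using C by (intro real_less_rsqrt) simp
  then have "C / sqrt (r - 1) < 1"
    using C r by simp
  then obtain q where q: "C / sqrt (r - 1) < q" "q < 1"
    using dense by blast
  have "0 < C / sqrt (r - 1)"
    using C r by simp
  then have q0: "0 < q"
    using q(1) by (rule less_trans)
  have D: "0 < C\<^sup>2 / q\<^sup>2" "C\<^sup>2 / q\<^sup>2 < r - 1"
  proof -
    have "C < q * sqrt (r - 1)"
      using q r by (simp add: pos_divide_less_eq)
    then have "C\<^sup>2 < (q * sqrt (r - 1))\<^sup>2"
      using C by (intro power_strict_mono) auto
    then show "C\<^sup>2 / q\<^sup>2 < r - 1"
      using r q0 by (simp add: power_mult_distrib pos_divide_less_eq mult.commute)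
  qed (use C q0 in simp)
  define lam where "lam n = 1 - (1 - q) / real n" for n
  have lam: "0 < lam (Suc n)" "lam (Suc n) < 1" "lam (Suc n) < lam (Suc (Suc n))" "lam 1 = q" for n
  proof -
    have "(1 - q) / real (Suc n) \<le> (1 - q) / 1"
      using q by (intro divide_left_mono) auto
    then show "0 < lam (Suc n)"
      using q0 by (simp add: lam_def)
    show "lam (Suc n) < 1" "lam 1 = q"
      using q by (simp_all add: lam_def)
    have "(1 - q) / real (Suc (Suc n)) < (1 - q) / real (Suc n)"
      using q by (intro divide_strict_left_mono) auto
    then show "lam (Suc n) < lam (Suc (Suc n))"
      by (simp add: lam_def)
  qed
  define u v w where "u n = (if n = 0 then 0 else lam n)" and "v n = (if n = 0 then C else 0)"
    and "w n = (if n = 0 then C else lam n)" for n :: nat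
  have u1: "\<bar>u n\<bar> \<le> 1" and vC: "\<bar>v n\<bar> \<le> C" and wC: "\<bar>w n\<bar> \<le> max C 1" for n
    using lam(1,2)[of "n - 1"] C0 by (cases n; simp add: u_def v_def w_def)+
  define T K S where "T = (weighted_series r u :: (nat \<Rightarrow> 'k) \<Rightarrow> _)"
    and "K = (weighted_series r v :: (nat \<Rightarrow> 'k) \<Rightarrow> _)"
    and "S = (weighted_series r w :: (nat \<Rightarrow> 'k) \<Rightarrow> _)"
  have uvw: "w = (\<lambda>n. u n + v n)"
    by (auto simp: u_def v_def w_def)
  have TK: "T x + K x = S x" if "x \<in> pts ?X" for x
    using weighted_series_add_weights[of r u 1 v C x] r u1 vC that
    by (simp add: T_def K_def S_def uvw)
  have linT: "linear_op ?X ?Y T" and linK: "linear_op ?X ?Y K"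
    unfolding T_def K_def using linear_op_weighted_series r u1 vC by blast+
  have opS: "op_norm ?X ?Y (\<lambda>x. T x + K x) = op_norm ?X ?Y S"
    unfolding op_norm_def by (intro SUP_cong) (auto simp: TK unit_ball_def)
  note op_upper = op_norm_weighted_series(2)[where w = w, OF r wC C0 khin, folded S_def]

  have bddT: "bounded_linear_op ?X ?Y T"
    unfolding bounded_linear_op_def T_def
    using linT weighted_series_norm_le[OF r u1 _ C0 khin]
    by (intro conjI exI[of _ "C * 1"]) (auto simp: T_def)
  have compK: "compact_op ?X ?Y K"
  proof (rule compact_op_first_coordinate)
    let ?\<epsilon> = "\<lambda>n. if n = 0 then 1 else 0 :: 'k"
    have \<epsilon>: "?\<epsilon> \<in> pts ?X"
      using summable_finite[of "{0}" "\<lambda>n. (norm (?\<epsilon> n))\<^sup>2"] by simp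
    then show "in_Lebesgue r (K ?\<epsilon>)"
      using linK by (simp add: linear_op_def)
    fix x assume "x \<in> pts ?X"
    have "(\<lambda>n. v n *\<^sub>R x n) = (\<lambda>n. v n *\<^sub>R scal ?X (x 0) ?\<epsilon> n)"
      by (simp add: v_def fun_eq_iff)
    then have "K x = K (scal ?X (x 0) ?\<epsilon>)"
      unfolding K_def weighted_series_def by (rule arg_cong)
    also have "\<dots> = scale_ae_fun (x 0) (K ?\<epsilon>)"
      using linK \<epsilon> by (simp add: linear_op_def)
    finally show "K x = scale_ae_fun (x 0) (K ?\<epsilon>)" .
  qed (use r linK in auto)

  have normT: "op_norm ?X ?Y T \<le> C"
    using op_norm_weighted_series(1)[where w = u, OF r u1 C0 khin] by (simp add: T_def)
  have normS: "C < op_norm ?X ?Y S"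
  proof -
    obtain s where s: "0 < s" "s < 1"
      "(1 + C\<^sup>2 / q\<^sup>2 * s\<^sup>2) powr (r / 2) < ((1 + s) powr r + (1 - s) powr r) / 2"
      using two_point_gain[OF D r] by blast
    \<comment> \<open>Chosen so that the two coefficients of the image of \<open>x\<close>, a multiple of \<open>(1, \<tau>, 0, \<dots>)\<close>, have the ratio \<open>s\<close>.\<close>
    define \<tau> where "\<tau> = C * s / q"
    define a where "a = 1 / sqrt (1 + \<tau>\<^sup>2)"
    have \<tau>: "0 < 1 + \<tau>\<^sup>2"
      by (simp add: add_pos_nonneg)
    have a: "0 < a" "a\<^sup>2 * (1 + \<tau>\<^sup>2) = 1"
      using \<tau> by (simp_all add: a_def power_divide)
    define x :: "nat \<Rightarrow> 'k" where "x n = (if n = 0 then of_real a else if n = 1 then of_real (a * \<tau>) else 0)" for n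
    have "(\<lambda>n. (norm (x n))\<^sup>2) sums (\<Sum>n\<in>{0,1}. (norm (x n))\<^sup>2)"
      by (intro sums_finite) (auto simp: x_def)
    also have "(\<Sum>n\<in>{0,1}. (norm (x n))\<^sup>2) = a\<^sup>2 * (1 + \<tau>\<^sup>2)"
      by (simp add: x_def norm_mult power_mult_distrib distrib_left)
    finally have x: "(\<lambda>n. (norm (x n))\<^sup>2) sums 1"
      unfolding a(2) .
    then have xsum: "summable (\<lambda>n. (norm (x n))\<^sup>2)" and xball: "x \<in> unit_ball ?X"
      by (auto simp: sums_iff unit_ball_def)
    have sx: "w 0 *\<^sub>R x 0 = of_real (C * a)" "w 1 *\<^sub>R x 1 = of_real (C * a * s)"
      using lam(4) q0 by (simp_all add: w_def x_def \<tau>_def scaleR_conv_of_real)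
    have "Lebesgue_norm r (S x) powr r = (norm (w 0 *\<^sub>R x 0 + w 1 *\<^sub>R x 1) powr r + norm (w 0 *\<^sub>R x 0 - w 1 *\<^sub>R x 1) powr r) / 2"
      unfolding S_def by (rule weighted_series_norm_finite_support[OF r wC xsum]) (simp add: x_def)
    also have "\<dots> = ((C * a * (1 + s)) powr r + (C * a * (1 - s)) powr r) / 2"
      unfolding sx of_real_add[symmetric] of_real_diff[symmetric] norm_of_real
      using C a s by (simp add: distrib_left right_diff_distrib abs_of_nonneg mult_left_le)
    also have "\<dots> = (C * a) powr r * (((1 + s) powr r + (1 - s) powr r) / 2)"
      unfolding powr_mult[of "C * a"] by (simp only: distrib_left times_divide_eq_right)
    also have "\<dots> > (C * a) powr r * (1 + C\<^sup>2 / q\<^sup>2 * s\<^sup>2) powr (r / 2)"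
      using s C a by (intro mult_strict_left_mono) auto
    also have "C\<^sup>2 / q\<^sup>2 * s\<^sup>2 = \<tau>\<^sup>2"
      by (simp add: \<tau>_def power_mult_distrib power_divide)
    also have "(C * a) powr r * (1 + \<tau>\<^sup>2) powr (r / 2) = C powr r * (a\<^sup>2 * (1 + \<tau>\<^sup>2)) powr (r / 2)"
    proof -
      have "a powr r = (a\<^sup>2) powr (r / 2)"
        using a by (simp add: powr_powr flip: powr_numeral)
      then show ?thesis
        by (simp add: powr_mult)
    qed
    finally have "C powr r < Lebesgue_norm r (S x) powr r"
      by (simp add: a)
    then have "C < Lebesgue_norm r (S x)"
      using powr_mono2[of r "Lebesgue_norm r (S x)" C] r by (force simp: Lebesgue_norm_nonneg)
    also have "\<dots> \<le> op_norm ?X ?Y S"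
      by (rule op_upper[OF xball])
    finally show ?thesis .
  qed

  have "\<not> norm_attaining ?X ?Y (\<lambda>x. T x + K x)"
  proof
    assume "norm_attaining ?X ?Y (\<lambda>x. T x + K x)"
    then obtain x where x: "x \<in> pts ?X" "nrm ?X x = 1" "nrm ?Y (T x + K x) = op_norm ?X ?Y S"
      unfolding norm_attaining_def opS by blast
    have xs: "summable (\<lambda>n. (norm (x n))\<^sup>2)" and x1: "(\<Sum>n. (norm (x n))\<^sup>2) = 1"
      and Sx: "Lebesgue_norm r (S x) = op_norm ?X ?Y S"
      using x TK[of x] by simp_all
    show False
    proof (cases "\<exists>i. x (Suc i) \<noteq> 0")
      case True
      then obtain i where "x (Suc i) \<noteq> 0" ..
      then have "Lebesgue_norm r (S x) < Lebesgue_norm r (S (spread_tail x))"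
        unfolding S_def using lam by (intro spread_tail_increases_norm[OF r wC xs]) (auto simp: w_def)
      moreover have "Lebesgue_norm r (S (spread_tail x)) \<le> op_norm ?X ?Y S"
        using spread_tail_norm[OF xs] x1 by (intro op_upper) (simp add: unit_ball_def)
      ultimately show False
        using Sx by simp
    next
      case False
      then have zero: "x n = 0" if "1 \<le> n" for n
        using that by (cases n) auto
      have "(\<Sum>n. (norm (x n))\<^sup>2) = (\<Sum>n\<in>{0}. (norm (x n))\<^sup>2)"
        using zero by (intro suminf_finite) auto
      then have "norm (x 0) = 1"
        using x1 by (intro power2_eq_imp_eq[of "norm (x 0)" 1]) simp_all
      moreover have "Lebesgue_norm r (S x) powr r = (norm (w 0 *\<^sub>R x 0 + w 1 *\<^sub>R x 1) powr r + norm (w 0 *\<^sub>R x 0 - w 1 *\<^sub>R x 1) powr r) / 2"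
        unfolding S_def by (rule weighted_series_norm_finite_support[OF r wC xs]) (simp add: zero)
      ultimately have "Lebesgue_norm r (S x) powr r \<le> C powr r"
        using C0 by (simp add: zero w_def)
      then have "Lebesgue_norm r (S x) \<le> C"
        by (rule powr_le_powr_imp_le) (use r C0 in \<open>auto simp: Lebesgue_norm_nonneg\<close>)
      then show False
        using Sx normS by simp
    qed
  qed
  moreover have "op_norm ?X ?Y T < op_norm ?X ?Y (\<lambda>x. T x + K x)"
    unfolding opS using normT normS by simp
  ultimately show False
    using CPP bddT compK unfolding compact_perturbation_property_def by blast
qed

theorem lemma3p1:
  fixes r :: real
  assumes "2 < r"
  shows "\<not> compact_perturbation_property
            (ell2 :: (real, nat \<Rightarrow> real) normed_space) (Lebesgue_space r)
       \<and> \<not> compact_perturbation_property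
            (ell2 :: (complex, nat \<Rightarrow> complex) normed_space) (Lebesgue_space r)"
  by (intro conjI not_compact_perturbation_property assms)

end
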